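(* Let $\mathcal L=\{L_1,\dots,L_s\}$ be a set of $s\ge3$ distinct skew lines in $\mathbb P^3_K$, $K$ a field. (a) $G_i$ is generated by the maps of the form $f_{jil}f_{ijk}$ and $f_{kij}f_{jkl}f_{ijk}$ (and hence $G_i$ is finitely generated). (b) $G_i$ is finite if and only if every element of $G_i$ has finite order. (c) The groups $G_i$ are all isomorphic and the sets $\mathrm{Hom}_{C_{\mathcal L}}(L_i,L_j)$ all have the same cardinality, so the set of arrows in $C_{\mathcal L}$ is finite if and only if $G_i$ is finite for some $i$. (d) $G_i$ is finite abelian if and only if the elements of the form $f_{jil}f_{ijk}$ and $f_{kij}f_{jkl}f_{ijk}$ commute and have finite order. (e) Let $K\subset K'$ be an extension of fields. Let $\mathcal L'$ be the lines in $\mathbb P^3_{K'}$ coming from the lines $\mathcal L$. The bijection $\mathcal L\to\mathcal L'$ given by $L\mapsto L'$ (where $L'$ is the line coming from $L$) induces a canonical isomorphism $C_{\mathcal L'}\cong C_{\mathcal L}$ of groupoids. In particular, the groups of the groupoids are canonically isomorphic. (f) Let $K\subset K'$ be an extension of fields, let $\mathcal L'$ be the lines in $\mathbb P^3_{K'}$ coming from $\mathcal L$ and let $\mathcal L''$ be a finite set of skew lines in $\mathbb P^3_{K'}$ with $\mathcal L'\subseteq\mathcal L''$. Then $C_{\mathcal L'}$ is a subgroupoid of $C_{\mathcal L''}$, so $G_{\mathcal L}$ is isomorphic to a subgroup of $G_{\mathcal L''}$. (g) If $K$ is finite, then $G_i$ is a subgroup of the group of permutations on the points of $L_i$, hence $G_i$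 is finite.
   Context: For distinct $i,j,k$ let $f_{ijk}\colon L_i\to L_j$ be the linear isomorphism sending $p\in L_i$ to the point where the plane spanned by $p$ and $L_k$ meets $L_j$. The groupoid $C_{\mathcal L}$ has the lines $L_i$ as objects and all possible compositions of the maps $f_{ijk}$ as arrows. Put $G_i=\mathrm{Hom}_{C_{\mathcal L}}(L_i,L_i)\subseteq\mathrm{Aut}(L_i)\cong PGL_2(K)$; $G_{\mathcal L}$ denotes any of these groups, called the group of the groupoid. In expressions such as $f_{jil}f_{ijk}$ (composition right to left) the indices range over all values in $\{1,\dots,s\}$ for which each individual map is defined, i.e. the three indices of each map are distinct. *)

theory Defs
  imports
    "HOL-Analysis.Cartesian_Space"
    "HOL-Library.Equipollence"
    "HOL-Algebra.Bij"
    "HOL-Algebra.Generated_Groups"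
begin

section \<open>Groupoids\<close>

text \<open>\<open>Comp C A B D g f\<close> is the composite of \<open>f\<close> from \<open>A\<close> to \<open>B\<close> followed by \<open>g\<close> from \<open>B\<close> to \<open>D\<close>.\<close>

record ('o, 'm) category =
  Ob :: "'o set"
  Hom :: "'o \<Rightarrow> 'o \<Rightarrow> 'm set"
  Id :: "'o \<Rightarrow> 'm"
  Comp :: "'o \<Rightarrow> 'o \<Rightarrow> 'o \<Rightarrow> 'm \<Rightarrow> 'm \<Rightarrow> 'm"

locale groupoid =
  fixes C :: "('o, 'm) category"
  assumes Id_in_Hom: "A \<in> Ob C \<Longrightarrow> Id C A \<in> Hom C A A"
    and Comp_in_Hom: "\<lbrakk>A \<in> Ob C; B \<in> Ob C; D \<in> Ob C; f \<in> Hom C A B; g \<in> Hom C B D\<rbrakk>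
      \<Longrightarrow> Comp C A B D g f \<in> Hom C A D"
    and Comp_Id_right: "\<lbrakk>A \<in> Ob C; B \<in> Ob C; f \<in> Hom C A B\<rbrakk> \<Longrightarrow> Comp C A A B f (Id C A) = f"
    and Comp_Id_left: "\<lbrakk>A \<in> Ob C; B \<in> Ob C; f \<in> Hom C A B\<rbrakk> \<Longrightarrow> Comp C A B B (Id C B) f = f"
    and Comp_assoc: "\<lbrakk>A \<in> Ob C; B \<in> Ob C; D \<in> Ob C; E \<in> Ob C;
        f \<in> Hom C A B; g \<in> Hom C B D; k \<in> Hom C D E\<rbrakk>
      \<Longrightarrow> Comp C A D E k (Comp C A B D g f) = Comp C A B E (Comp C B D E k g) f"
    and inverse_ex: "\<lbrakk>A \<in> Ob C; B \<in> Ob C; f \<in> Hom C A B\<rbrakk>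
      \<Longrightarrow> \<exists>g\<in>Hom C B A. Comp C A B A g f = Id C A \<and> Comp C B A B f g = Id C B"

text \<open>The same underlying function may occur in several hom-sets, so arrows carry their source
  and target.\<close>

definition arrows :: "('o, 'm) category \<Rightarrow> ('o \<times> 'm \<times> 'o) set" where
  "arrows C = {(A, f, B). A \<in> Ob C \<and> B \<in> Ob C \<and> f \<in> Hom C A B}"

definition vertex_group :: "('o, 'm) category \<Rightarrow> 'o \<Rightarrow> 'm monoid" where
  "vertex_group C A = \<lparr>carrier = Hom C A A, mult = Comp C A A A, one = Id C A\<rparr>"

definition groupoid_iso ::
    "('o, 'm) category \<Rightarrow> ('p, 'n) category \<Rightarrow> ('o \<Rightarrow> 'p) \<Rightarrow> ('o \<Rightarrow> 'o \<Rightarrow> 'm \<Rightarrow> 'n) \<Rightarrow> bool" where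
  "groupoid_iso C D F \<Phi> \<longleftrightarrow> groupoid C \<and> groupoid D \<and>
     bij_betw F (Ob C) (Ob D) \<and>
     (\<forall>A\<in>Ob C. \<forall>B\<in>Ob C. bij_betw (\<Phi> A B) (Hom C A B) (Hom D (F A) (F B))) \<and>
     (\<forall>A\<in>Ob C. \<Phi> A A (Id C A) = Id D (F A)) \<and>
     (\<forall>A\<in>Ob C. \<forall>B\<in>Ob C. \<forall>E\<in>Ob C. \<forall>f\<in>Hom C A B. \<forall>g\<in>Hom C B E.
        \<Phi> A E (Comp C A B E g f) = Comp D (F A) (F B) (F E) (\<Phi> B E g) (\<Phi> A B f))"

definition subgroupoid :: "('o, 'm) category \<Rightarrow> ('o, 'm) category \<Rightarrow> bool" where
  "subgroupoid C D \<longleftrightarrow> groupoid C \<and> groupoid D \<and>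
     Ob C \<subseteq> Ob D \<and>
     (\<forall>A\<in>Ob C. \<forall>B\<in>Ob C. Hom C A B \<subseteq> Hom D A B) \<and>
     (\<forall>A\<in>Ob C. Id C A = Id D A) \<and>
     (\<forall>A\<in>Ob C. \<forall>B\<in>Ob C. \<forall>E\<in>Ob C. \<forall>f\<in>Hom C A B. \<forall>g\<in>Hom C B E.
        Comp C A B E g f = Comp D A B E g f)"

definition finite_order :: "('m, 'z) monoid_scheme \<Rightarrow> 'm \<Rightarrow> bool" where
  "finite_order G x \<longleftrightarrow> (\<exists>n::nat. n > 0 \<and> x [^]\<^bsub>G\<^esub> n = \<one>\<^bsub>G\<^esub>)"


section \<open>Lines in projective 3-space\<close>

text \<open>A linear subspace of projective 3-space over a field is represented by the vector subspace of
  the coordinate space that it is the projectivization of: points have vector space dimension 1 and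
  lines have vector space dimension 2, and a point lies on a line iff it is a subset of it.\<close>

type_synonym 'a subsp = "('a ^ 4) set"

definition is_line :: "'a::field subsp \<Rightarrow> bool" where
  "is_line L \<longleftrightarrow> vec.subspace L \<and> vec.dim L = 2"

definition points :: "'a::field subsp \<Rightarrow> 'a subsp set" where
  "points L = {p. vec.subspace p \<and> vec.dim p = 1 \<and> p \<subseteq> L}"

definition skew :: "'a::field subsp \<Rightarrow> 'a subsp \<Rightarrow> bool" where
  "skew L M \<longleftrightarrow> points L \<inter> points M = {}"

definition skew_lines :: "'a::field subsp set \<Rightarrow> bool" where
  "skew_lines \<L> \<longleftrightarrow> finite \<L> \<and> (\<forall>L\<in>\<L>. is_line L) \<and> (\<forall>L\<in>\<L>. \<forall>M\<in>\<L>. L \<noteq> M \<longrightarrow> skew L M)"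

text \<open>\<open>line_map L M N\<close> is the map from \<open>L\<close> to \<open>M\<close> by projection from \<open>N\<close>, that is
  \<open>f\<^sub>i\<^sub>j\<^sub>k\<close> for \<open>L = L\<^sub>i\<close>, \<open>M = L\<^sub>j\<close> and \<open>N = L\<^sub>k\<close>. The span of \<open>p \<union> N\<close> is the plane spanned
  by \<open>p\<close> and \<open>N\<close>. Maps between lines are extensional functions on rational points; this loses
  nothing, as a linear isomorphism of projective lines is determined by its values on rational
  points over every field.\<close>

definition line_map :: "'a::field subsp \<Rightarrow> 'a subsp \<Rightarrow> 'a subsp \<Rightarrow> 'a subsp \<Rightarrow> 'a subsp" where
  "line_map L M N = (\<lambda>p\<in>points L. vec.span (p \<union> N) \<inter> M)"

inductive is_arrow ::
    "'a::field subsp set \<Rightarrow> 'a subsp \<Rightarrow> 'a subsp \<Rightarrow> ('a subsp \<Rightarrow> 'a subsp) \<Rightarrow> bool"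
  for \<L> :: "'a subsp set" where
  identity: "L \<in> \<L> \<Longrightarrow> is_arrow \<L> L L (\<lambda>p\<in>points L. p)"
| generator: "\<lbrakk>L \<in> \<L>; M \<in> \<L>; N \<in> \<L>; distinct [L, M, N]\<rbrakk> \<Longrightarrow> is_arrow \<L> L M (line_map L M N)"
| composite: "\<lbrakk>is_arrow \<L> L M f; is_arrow \<L> M N g\<rbrakk> \<Longrightarrow> is_arrow \<L> L N (compose (points L) g f)"

definition line_groupoid :: "'a::field subsp set \<Rightarrow> ('a subsp, 'a subsp \<Rightarrow> 'a subsp) category" where
  "line_groupoid \<L> =
     \<lparr>Ob = \<L>,
      Hom = (\<lambda>L M. {f. is_arrow \<L> L M f}),
      Id = (\<lambda>L. \<lambda>p\<in>points L. p),
      Comp = (\<lambda>L M N g f. compose (points L) g f)\<rparr>"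

definition line_group :: "'a::field subsp set \<Rightarrow> 'a subsp \<Rightarrow> ('a subsp \<Rightarrow> 'a subsp) monoid" where
  "line_group \<L> L = vertex_group (line_groupoid \<L>) L"

text \<open>With \<open>L = L\<^sub>i\<close>, the two sets below consist of the \<open>f\<^sub>j\<^sub>i\<^sub>l f\<^sub>i\<^sub>j\<^sub>k\<close> and of the
  \<open>f\<^sub>k\<^sub>i\<^sub>j f\<^sub>j\<^sub>k\<^sub>l f\<^sub>i\<^sub>j\<^sub>k\<close>, for \<open>M = L\<^sub>j\<close>, \<open>N = L\<^sub>k\<close> and \<open>P = L\<^sub>l\<close>. Only the indices of each
  single map are distinct: \<open>l = k\<close> is allowed in the first set and \<open>l = i\<close> in the second.\<close>

definition two_step_loops :: "'a::field subsp set \<Rightarrow> 'a subsp \<Rightarrow> ('a subsp \<Rightarrow> 'a subsp) set" where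
  "two_step_loops \<L> L =
     {compose (points L) (line_map M L P) (line_map L M N) | M N P.
        M \<in> \<L> \<and> N \<in> \<L> \<and> P \<in> \<L> \<and> distinct [L, M, N] \<and> distinct [M, L, P]}"

definition three_step_loops :: "'a::field subsp set \<Rightarrow> 'a subsp \<Rightarrow> ('a subsp \<Rightarrow> 'a subsp) set" where
  "three_step_loops \<L> L =
     {compose (points L) (line_map N L M) (compose (points L) (line_map M N P) (line_map L M N))
        | M N P. M \<in> \<L> \<and> N \<in> \<L> \<and> P \<in> \<L> \<and>
            distinct [L, M, N] \<and> distinct [M, N, P] \<and> distinct [N, L, M]}"

definition basic_loops :: "'a::field subsp set \<Rightarrow> 'a subsp \<Rightarrow> ('a subsp \<Rightarrow> 'a subsp) set" where
  "basic_loops \<L> L = two_step_loops \<L> L \<union> three_step_loops \<L> L"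


subsection \<open>The groupoid and the groups are well defined\<close>

lemma skew_imp_Int:
  assumes L: "is_line L" and M: "is_line M" and s: "skew L M"
  shows "L \<inter> M = {0}"
proof (rule ccontr)
  have sub: "vec.subspace L" "vec.subspace M" using L M by (simp_all add: is_line_def)
  have "0 \<in> L \<inter> M" using sub vec.subspace_0 by blast
  moreover assume "L \<inter> M \<noteq> {0}"
  ultimately obtain v where v: "v \<in> L" "v \<in> M" "v \<noteq> 0" by blast
  have "vec.dim (vec.span {v}) = 1"
    using vec.dim_span_eq_card_independent[of "{v}"] v by simp
  moreover have "vec.span {v} \<subseteq> L" "vec.span {v} \<subseteq> M"
    using v sub by (simp_all add: vec.span_minimal)
  ultimately have "vec.span {v} \<in> points L \<inter> points M"
    by (simp add: points_def vec.subspace_span)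
  with s show False by (simp add: skew_def)
qed

lemma dim_join:
  assumes A: "vec.subspace A" and B: "vec.subspace B" and "A \<inter> B = {0}"
  shows "vec.dim (vec.span (A \<union> B)) = vec.dim A + vec.dim B"
proof -
  have "vec.span A = A" "vec.span B = B" using A B by (simp_all only: vec.span_eq_iff)
  then have "vec.span (A \<union> B) = {x + y |x y. x \<in> A \<and> y \<in> B}"
    by (simp only: vec.span_Un)
  moreover have "vec.dim (A \<inter> B) = 0" unfolding assms(3) by simp
  ultimately show ?thesis using vec.dim_sums_Int[OF A B] by (simp only: add_0_right)
qed

lemma line_map_point:
  fixes L M N :: "'a::field subsp"
  assumes L: "is_line L" and M: "is_line M" and N: "is_line N"
    and s: "skew L N" "skew M N" and p: "p \<in> points L"
  shows "line_map L M N p \<in> points M" and "line_map M L N (line_map L M N p) = p"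
proof -
  have sub: "vec.subspace L" "vec.subspace M" "vec.subspace N" "vec.subspace p" "p \<subseteq> L"
    and d: "vec.dim L = 2" "vec.dim M = 2" "vec.dim N = 2" "vec.dim p = 1"
    using L M N p by (auto simp: is_line_def points_def)
  have LN: "L \<inter> N = {0}" and MN: "M \<inter> N = {0}" using assms skew_imp_Int by blast+
  have pl: "vec.dim (vec.span (q \<union> N)) = 3" if "q \<in> points X" "X \<inter> N = {0}" for q X
  proof -
    have "q \<inter> N = {0}" using that vec.subspace_0[of q] vec.subspace_0[OF sub(3)] by (auto simp: points_def)
    then show ?thesis using dim_join[of q N] that sub d by (auto simp: points_def)
  qed
  have cut: "vec.span (q \<union> N) \<inter> Y \<in> points Y"
    if q: "q \<in> points X" and X: "X \<inter> N = {0}" and Y: "is_line Y" "Y \<inter> N = {0}" for q X Y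
  proof -
    let ?H = "vec.span (q \<union> N)"
    have sY: "vec.subspace Y" "vec.dim Y = 2" using Y by (auto simp: is_line_def)
    have sI: "vec.subspace (?H \<inter> Y)" using sY vec.subspace_inter vec.subspace_span by blast
    have "vec.dim {x + y |x y. x \<in> ?H \<and> y \<in> Y} + vec.dim (?H \<inter> Y) = 3 + 2"
      using vec.dim_sums_Int[OF vec.subspace_span[of "q \<union> N"] sY(1)] pl[OF q X] sY by simp
    moreover have "vec.dim {x + y |x y. x \<in> ?H \<and> y \<in> Y} \<le> 4"
      using vec.dim_subset[OF subset_UNIV, where 'b = 4] unfolding vec_dim_card by simp
    moreover have "vec.dim (?H \<inter> Y) + 2 \<le> 3"
    proof -
      have "(?H \<inter> Y) \<inter> N = {0}" using Y(2) vec.subspace_0[OF sI] vec.subspace_0[OF sub(3)] by blast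
      then have "vec.dim (vec.span ((?H \<inter> Y) \<union> N)) = vec.dim (?H \<inter> Y) + 2"
        using dim_join[OF sI sub(3)] d by simp
      moreover have "vec.span ((?H \<inter> Y) \<union> N) \<subseteq> ?H"
        by (rule vec.span_minimal) (auto intro: vec.span_base vec.subspace_span)
      ultimately show ?thesis using vec.dim_subset pl[OF q X] by metis
    qed
    ultimately show ?thesis using sI by (auto simp: points_def)
  qed
  let ?q = "vec.span (p \<union> N) \<inter> M"
  have q: "?q \<in> points M" using cut[OF p LN M MN] .
  then show 1: "line_map L M N p \<in> points M" using p by (simp add: line_map_def)
  have "vec.span (?q \<union> N) \<subseteq> vec.span (p \<union> N)"
    by (rule vec.span_minimal) (auto intro: vec.span_base vec.subspace_span)
  then have eq: "vec.span (?q \<union> N) = vec.span (p \<union> N)"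
    using pl[OF q MN] pl[OF p LN] by (intro vec.subspace_dim_equal) auto
  have r: "vec.span (p \<union> N) \<inter> L \<in> points L" using cut[OF p LN L LN] .
  have "p \<subseteq> vec.span (p \<union> N) \<inter> L" using sub by (auto intro: vec.span_base)
  then have "p = vec.span (p \<union> N) \<inter> L"
    using r d sub by (intro vec.subspace_dim_equal) (auto simp: points_def)
  then show "line_map M L N (line_map L M N p) = p"
    using p q eq by (simp add: line_map_def)
qed

lemma line_map_ext: "line_map L M N \<in> extensional (points L)" by (simp add: line_map_def)

lemma is_arrow_props:
  assumes "skew_lines \<L>" "is_arrow \<L> L M f"
  shows "L \<in> \<L> \<and> M \<in> \<L> \<and> f \<in> extensional (points L) \<and> (\<forall>p\<in>points L. f p \<in> points M) \<and>
    (\<exists>g. is_arrow \<L> M L g \<and> (\<forall>q\<in>points M. g q \<in> points L) \<and>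
       (\<forall>p\<in>points L. g (f p) = p) \<and> (\<forall>q\<in>points M. f (g q) = q))"
  using assms(2)
proof induction
  case (identity L)
  define e where "e = (\<lambda>p\<in>points L. p)"
  have "is_arrow \<L> L L e" using identity is_arrow.identity by (simp only: e_def)
  moreover have "e \<in> extensional (points L)" unfolding e_def by (rule restrict_extensional)
  moreover have "\<forall>p\<in>points L. e p = p" by (simp add: e_def)
  ultimately show ?case using identity unfolding e_def[symmetric]
    by (intro conjI exI[of _ e]) simp_all
next
  case (generator L M N)
  have l: "is_line L" "is_line M" "is_line N" "skew L N" "skew M N"
    using generator assms(1) by (simp_all add: skew_lines_def)
  have "is_arrow \<L> M L (line_map M L N)" using generator by (intro is_arrow.generator) auto
  moreover have "\<forall>p\<in>points L. line_map L M N p \<in> points M"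
    "\<forall>q\<in>points M. line_map M L N q \<in> points L"
    "\<forall>p\<in>points L. line_map M L N (line_map L M N p) = p"
    "\<forall>q\<in>points M. line_map L M N (line_map M L N q) = q"
    using line_map_point[OF l] line_map_point[OF l(2,1,3,5,4)] by simp_all
  ultimately show ?case using generator(1,2) line_map_ext
    by (intro conjI exI[of _ "line_map M L N"])
next
  case (composite L M f N g)
  from composite.IH(1) obtain f' where f':
    "is_arrow \<L> M L f'" "\<forall>q\<in>points M. f' q \<in> points L"
    "\<forall>p\<in>points L. f' (f p) = p" "\<forall>q\<in>points M. f (f' q) = q"
    by (elim conjE exE) (rule that)
  from composite.IH(2) obtain g' where g':
    "is_arrow \<L> N M g'" "\<forall>q\<in>points N. g' q \<in> points M"
    "\<forall>p\<in>points M. g' (g p) = p" "\<forall>q\<in>points N. g (g' q) = q"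
    by (elim conjE exE) (rule that)
  have fg: "L \<in> \<L>" "N \<in> \<L>" "\<forall>p\<in>points L. f p \<in> points M" "\<forall>p\<in>points M. g p \<in> points N"
    using composite.IH(1)[THEN conjunct1] composite.IH(2)[THEN conjunct2, THEN conjunct1]
      composite.IH(1)[THEN conjunct2, THEN conjunct2, THEN conjunct2, THEN conjunct1]
      composite.IH(2)[THEN conjunct2, THEN conjunct2, THEN conjunct2, THEN conjunct1] .
  have "is_arrow \<L> N L (compose (points N) f' g')" using g'(1) f'(1) by (rule is_arrow.composite)
  with f'(2-) g'(2-) fg show ?case
    by (intro conjI exI[of _ "compose (points N) f' g'"]) (simp_all add: compose_eq)
qed

theorem groupoid_line_groupoid: assumes "skew_lines \<L>" shows "groupoid (line_groupoid \<L>)"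
proof -
  note P = is_arrow_props[OF assms]
  show ?thesis
  proof (unfold_locales, goal_cases)
    case (1 A) then show ?case by (simp add: line_groupoid_def is_arrow.identity)
  next case 2 then show ?case by (auto simp: line_groupoid_def intro: is_arrow.composite)
  next case (3 A B f) then show ?case using P[of A B f] by (auto simp: line_groupoid_def compose_def fun_eq_iff extensional_def)
  next case (4 A B f) then show ?case using P[of A B f] by (auto simp: line_groupoid_def compose_def fun_eq_iff extensional_def Pi_iff)
  next case (5 A B D E f g k) then show ?case using P[of A B f] by (auto simp: line_groupoid_def compose_def fun_eq_iff extensional_def Pi_iff)
  next
    case (6 A B f)
    then obtain g where "is_arrow \<L> B A g"
       "(\<forall>p\<in>points A. g (f p) = p) \<and> (\<forall>q\<in>points B. f (g q) = q)" using P[of A B f] by (auto simp: line_groupoid_def)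
    then show ?case by (intro bexI[of _ g]) (auto simp: line_groupoid_def compose_def fun_eq_iff)
  qed
qed

lemma group_line_group: assumes "skew_lines \<L>" "L \<in> \<L>" shows "group (line_group \<L> L)"
proof -
  interpret groupoid "line_groupoid \<L>" using assms groupoid_line_groupoid by blast
  have L: "L \<in> Ob (line_groupoid \<L>)" using assms by (simp add: line_groupoid_def)
  show ?thesis unfolding line_group_def vertex_group_def
    using Comp_assoc[OF L L L L] Comp_in_Hom[OF L L L] Id_in_Hom[OF L] Comp_Id_left[OF L L]
      inverse_ex[OF L L]
    by (intro groupI) (simp_all, blast)
qed


section \<open>Extension of the base field\<close>

text \<open>Being a ring homomorphism between fields, such a map is automatically injective.\<close>

definition field_extension :: "('a::field \<Rightarrow> 'b::field) \<Rightarrow> bool" where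
  "field_extension h \<longleftrightarrow>
     h 1 = 1 \<and> (\<forall>x y. h (x + y) = h x + h y) \<and> (\<forall>x y. h (x * y) = h x * h y)"

definition base_change :: "('a::field \<Rightarrow> 'b::field) \<Rightarrow> 'a subsp \<Rightarrow> 'b subsp" where
  "base_change h L = vec.span ((\<lambda>v. \<chi> i. h (v $ i)) ` L)"

definition canonical_iso ::
    "('a::field \<Rightarrow> 'b::field) \<Rightarrow> 'a subsp set \<Rightarrow>
     ('a subsp \<Rightarrow> 'a subsp \<Rightarrow> ('a subsp \<Rightarrow> 'a subsp) \<Rightarrow> ('b subsp \<Rightarrow> 'b subsp)) \<Rightarrow> bool" where
  "canonical_iso h \<L> \<Phi> \<longleftrightarrow>
     groupoid_iso (line_groupoid \<L>) (line_groupoid (base_change h ` \<L>)) (base_change h) \<Phi> \<and>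
     (\<forall>L\<in>\<L>. \<forall>M\<in>\<L>. \<forall>N\<in>\<L>. distinct [L, M, N] \<longrightarrow>
        \<Phi> L M (line_map L M N) = line_map (base_change h L) (base_change h M) (base_change h N))"

end

(* Every arrow is induced by a matrix, a generator f_ijk by the projection onto L_j along L_k.
   Matrices can be extended to a larger field, and two of them induce the same map between lines iff
   they are proportional there, over either field; this gives (e) and (f). For (a), join every line
   to L_i by an edge: an arrow closed up along these edges is a product of basic loops, up to changes
   of the third index, which are absorbed by two-step loops.

   The substance is (b), Burnside's problem for PGL_2(K). Over the algebraic closure the generators
   can be scaled to determinant 1, so that one deals with a finitely generated torsion group in SL_2.
   Traces of torsion elements are integral over Z, and by g h + h g = tr(h) g + tr(g) h + c the
   subring of M_2 generated by the generators and finitely many traces is a finitely generated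
   additive group. In positive characteristic it is finite. In characteristic 0 a torsion element
   congruent to 1 modulo 4 in this ring is 1, as otherwise the ring would contain 1/2; hence
   the group embeds into a finite set of residues modulo 4. *)

theory Submission
  imports Defs "HOL-Algebra.Algebraic_Closure_Type"
begin

section \<open>Finitely generated additive subgroups of a ring\<close>

text \<open>Determinant 1 matters because the inverse of A is then tr(A) - A: A^k + A^(-k) becomes a
  monic integer polynomial in tr(A), and A^n = 1 turns into a monic equation for the trace. Reaching
  determinant 1 takes a square root, hence the algebraic closure. The price is the kernel of the map
  from SL_2 to PGL_2: the identity lifts to 1 or -1, and exponents double. The modulus 4 is forced
  by -1, which has order 2 and is congruent to 1 modulo 2. That 1/2 is missing from the ring is
  Nakayama's lemma at the prime 2: otherwise the ring would be twice itself, and an odd integer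
  would kill it. In (e) the matrices are 4 by 4, in the coordinates of the ambient space, and
  injectivity on a line is recorded by a second matrix that undoes the first. All this consists of
  linear conditions on the lines, which pass to spans over K'. In the other direction, the ratio of
  two proportional vectors over K lies in K even if it is formed over K'.\<close>

primrec zspan :: "'r::ring_1 list \<Rightarrow> 'r set" where
  "zspan [] = {0}"
| "zspan (b # bs) = {of_int k * b + m | k m. m \<in> zspan bs}"

lemma zspan_Cons_I: "m \<in> zspan bs \<Longrightarrow> of_int k * b + m \<in> zspan (b # bs)"
  by auto

lemma zspan_0: "0 \<in> zspan bs"
proof (induction bs)
  case (Cons b bs)
  then show ?case using zspan_Cons_I[of 0 bs 0 b] by simp
qed simp

lemma zspan_diff: "x \<in> zspan bs \<Longrightarrow> y \<in> zspan bs \<Longrightarrow> x - y \<in> zspan bs"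
proof (induction bs arbitrary: x y)
  case (Cons b bs)
  then obtain k m l n where *: "x = of_int k * b + m" "y = of_int l * b + n" "m \<in> zspan bs" "n \<in> zspan bs"
    by auto
  have "x - y = of_int (k - l) * b + (m - n)" by (simp add: * algebra_simps)
  with Cons.IH[OF *(3,4)] show ?case by (metis zspan_Cons_I)
qed simp

lemma zspan_uminus: "x \<in> zspan bs \<Longrightarrow> - x \<in> zspan bs"
  using zspan_diff[OF zspan_0, of x] by simp

lemma zspan_add: "x \<in> zspan bs \<Longrightarrow> y \<in> zspan bs \<Longrightarrow> x + y \<in> zspan bs"
  using zspan_diff[OF _ zspan_uminus, of x bs y] by simp

lemma zspan_base: "b \<in> set bs \<Longrightarrow> b \<in> zspan bs"
proof (induction bs)
  case (Cons c bs)
  show ?case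
  proof (cases "b = c")
    case True
    then show ?thesis using zspan_Cons_I[OF zspan_0, of 1 c bs] by simp
  next
    case False
    then have "b \<in> zspan bs" using Cons by simp
    then show ?thesis using zspan_Cons_I[of b bs 0 c] by simp
  qed
qed simp

lemma int_multiple_closed:
  fixes x :: "'r::ring_1"
  assumes "0 \<in> U" "\<And>x y. x \<in> U \<Longrightarrow> y \<in> U \<Longrightarrow> x - y \<in> U" and x: "x \<in> U"
  shows "of_int k * x \<in> U"
proof -
  have add: "a + b \<in> U" if "a \<in> U" "b \<in> U" for a b
    using assms(2)[OF that(1) assms(2)[OF assms(1) that(2)]] by simp
  have n: "of_nat n * x \<in> U" for n
    by (induction n) (use assms add in \<open>auto simp: algebra_simps\<close>)
  show ?thesis
  proof (cases "k \<ge> 0")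
    case True
    then show ?thesis using n[of "nat k"] by simp
  next
    case False
    then show ?thesis using assms(2)[OF assms(1) n[of "nat (- k)"]] by simp
  qed
qed

text \<open>Serves as the induction rule for \<open>zspan\<close>: the set U is usually an
  annihilator or the preimage of another span, and only the generators have to be checked.\<close>

lemma zspan_least:
  assumes "0 \<in> U" "\<And>x y. x \<in> U \<Longrightarrow> y \<in> U \<Longrightarrow> x - y \<in> U" "set bs \<subseteq> U"
  shows "zspan bs \<subseteq> U"
  using assms(3)
proof (induction bs)
  case (Cons b bs)
  have add: "a + b \<in> U" if "a \<in> U" "b \<in> U" for a b
    using assms(2)[OF that(1) assms(2)[OF assms(1) that(2)]] by simp
  from Cons show ?case using int_multiple_closed[OF assms(1,2)] by (auto intro!: add)
qed (use assms in simp)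

lemma zspan_subset: "set as \<subseteq> zspan bs \<Longrightarrow> zspan as \<subseteq> zspan bs"
  by (intro zspan_least zspan_0 zspan_diff)

lemma zspan_mono: "set as \<subseteq> set bs \<Longrightarrow> zspan as \<subseteq> zspan bs"
  by (meson subsetD subsetI zspan_base zspan_subset)

lemma zspan_of_int: "x \<in> zspan bs \<Longrightarrow> of_int k * x \<in> zspan bs"
  by (rule int_multiple_closed[OF zspan_0 zspan_diff])

lemma zspan_of_nat: "x \<in> zspan bs \<Longrightarrow> of_nat k * x \<in> zspan bs"
  using zspan_of_int[of x bs "int k"] by simp

lemma zspan_mult_right_closed:
  assumes "\<And>b. b \<in> set bs \<Longrightarrow> b * c \<in> zspan cs" "x \<in> zspan bs"
  shows "x * c \<in> zspan cs"
proof -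
  have "zspan bs \<subseteq> {x. x * c \<in> zspan cs}"
    by (rule zspan_least) (use assms in \<open>auto simp: zspan_0 left_diff_distrib zspan_diff\<close>)
  with assms show ?thesis by auto
qed

lemma zspan_mult_left_closed:
  assumes "\<And>b. b \<in> set bs \<Longrightarrow> c * b \<in> zspan cs" "x \<in> zspan bs"
  shows "c * x \<in> zspan cs"
proof -
  have "zspan bs \<subseteq> {x. c * x \<in> zspan cs}"
    by (rule zspan_least) (use assms in \<open>auto simp: zspan_0 right_diff_distrib zspan_diff\<close>)
  with assms show ?thesis by auto
qed

text \<open>Division of each coefficient by n leaves finitely many remainders. If n is the
  characteristic, the multiple of n vanishes and the span itself is finite; for n = 4 the set F
  receives the torsion group in characteristic 0.\<close>

lemma zspan_residues:
  assumes "n > 0"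
  shows "\<exists>F. finite F \<and> (\<forall>m\<in>zspan bs. \<exists>f\<in>F. \<exists>m'\<in>zspan bs. m = f + of_nat n * m')"
proof (induction bs)
  case Nil
  then show ?case by (intro exI[of _ "{0}"]) simp
next
  case (Cons b bs)
  then obtain F where F: "finite F" "\<forall>m\<in>zspan bs. \<exists>f\<in>F. \<exists>m'\<in>zspan bs. m = f + of_nat n * m'" by auto
  let ?F = "(\<lambda>(k, f). of_int k * b + f) ` ({0..int n} \<times> F)"
  have "\<exists>f\<in>?F. \<exists>m'\<in>zspan (b # bs). m = f + of_nat n * m'" if "m \<in> zspan (b # bs)" for m
  proof -
    from that obtain k m1 where m: "m = of_int k * b + m1" "m1 \<in> zspan bs" by auto
    then obtain f m' where f: "f \<in> F" "m' \<in> zspan bs" "m1 = f + of_nat n * m'" using F(2) by blast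
    have "of_int k = (of_int (k mod int n) + of_nat n * of_int (k div int n) :: 'a)"
      using mult_div_mod_eq[of "int n" k]
      by (metis add.commute of_int_add of_int_mult of_int_of_nat_eq)
    then have "m = (of_int (k mod int n) * b + f) + of_nat n * (of_int (k div int n) * b + m')"
      by (simp add: m f algebra_simps)
    moreover have "of_int (k mod int n) * b + f \<in> ?F"
      using assms f by (intro image_eqI[of _ _ "(k mod int n, f)"]) (auto simp: less_imp_le)
    ultimately show ?thesis using zspan_Cons_I[OF f(2)] by blast
  qed
  moreover have "finite ?F" using F by simp
  ultimately show ?case by blast
qed

lemma of_int_mult_left_commute: "of_int a * (of_int b * x) = of_int b * (of_int a * (x :: 'r::ring_1))"
  by (metis mult.assoc mult_of_int_commute)

text \<open>Nakayama's lemma at the prime 2, by elimination of one generator at a time.\<close>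

lemma zspan_two_divisible_imp_torsion:
  assumes "\<forall>b\<in>set bs. \<exists>n. odd n \<and> (\<exists>m\<in>zspan bs. of_int n * b = m + m)"
  shows "\<exists>n. odd n \<and> (\<forall>b\<in>set bs. of_int n * b = (0 :: 'r::ring_1))"
  using assms
proof (induction bs)
  case Nil
  then show ?case by (intro exI[of _ 1]) simp
next
  case (Cons b bs)
  then obtain n k m where n: "odd n" and m: "m \<in> zspan bs"
    "of_int n * b = (of_int k * b + m) + (of_int k * b + m)" by auto
  \<comment> \<open>The multiples of b are moved to the left: (n - 2k) b = 2m, and n - 2k is still
    odd. Once a relation of another generator is multiplied by N, the term 2jb in it can be replaced
    by an element of the smaller span. Odd factors thus accumulate, which is why the hypothesis
    admits them.\<close>
  define N where "N = n - k - k"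
  have "of_int N * b = of_int n * b - of_int k * b - of_int k * b"
    by (simp only: N_def of_int_diff left_diff_distrib)
  then have N: "odd N" "of_int N * b = m + m" using n m(2) by (auto simp: N_def)
  have "\<exists>l. odd l \<and> (\<exists>m\<in>zspan bs. of_int l * c = m + m)" if "c \<in> set bs" for c
  proof -
    from Cons.prems that obtain l j r where l: "odd l" "r \<in> zspan bs"
      "of_int l * c = (of_int j * b + r) + (of_int j * b + r)"
      by auto
    have "of_int N * (of_int j * b + r) = of_int j * (m + m) + of_int N * r"
      by (simp only: distrib_left of_int_mult_left_commute[of N j] N)
    also have "\<dots> \<in> zspan bs" using m l by (intro zspan_add zspan_of_int)
    finally have "of_int N * (of_int j * b + r) \<in> zspan bs" .
    moreover have "of_int (N * l) * c = of_int N * (of_int j * b + r) + of_int N * (of_int j * b + r)"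
      using l(3) by (simp only: of_int_mult mult.assoc distrib_left)
    moreover have "odd (N * l)" using N l by simp
    ultimately show ?thesis by blast
  qed
  with Cons.IH obtain e where e: "odd e" "\<forall>b\<in>set bs. of_int e * b = 0" by auto
  have "zspan bs \<subseteq> {x. of_int e * x = 0}"
    by (rule zspan_least) (use e in \<open>auto simp: right_diff_distrib\<close>)
  then have "of_int e * m = 0" using m by auto
  then have "of_int (e * N) * b = 0" by (simp add: N mult.assoc distrib_left)
  moreover have "of_int (e * N) * c = 0" if "c \<in> set bs" for c
    using e that of_int_mult_left_commute[of e N c] by (simp add: mult.assoc)
  ultimately show ?case using e N by (intro exI[of _ "e * N"]) auto
qed

text \<open>If x were 1/2, every generator would be b = x b + x b, twice an element of the span. The
  previous lemma then gives an odd integer that kills all generators and with them 1, against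
  characteristic 0.\<close>

lemma half_notin_zspan_ring:
  fixes x :: "'r::ring_1"
  assumes char0: "\<And>k. of_int k = (0 :: 'r) \<Longrightarrow> k = 0"
    and one: "1 \<in> zspan bs" and mult: "\<And>a b. a \<in> zspan bs \<Longrightarrow> b \<in> zspan bs \<Longrightarrow> a * b \<in> zspan bs"
    and x: "x \<in> zspan bs"
  shows "x + x \<noteq> 1"
proof
  assume h: "x + x = 1"
  have "\<exists>n. odd n \<and> (\<exists>m\<in>zspan bs. of_int n * b = m + m)" if "b \<in> set bs" for b
  proof -
    have "of_int 1 * b = x * b + x * b" using h by (simp flip: distrib_right)
    then show ?thesis using mult[OF x zspan_base[OF that]] by (intro exI[of _ 1]) auto
  qed
  then obtain n where n: "odd n" "\<forall>b\<in>set bs. of_int n * b = 0"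
    using zspan_two_divisible_imp_torsion by blast
  have "zspan bs \<subseteq> {x. of_int n * x = 0}"
    by (rule zspan_least) (use n in \<open>auto simp: right_diff_distrib\<close>)
  then have "of_int n = (0 :: 'r)" using one by auto
  then show False using char0 n by auto
qed

section \<open>Subrings that are finitely generated as additive groups\<close>

inductive_set subring_gen :: "'r::ring_1 set \<Rightarrow> 'r set" for S where
  one: "1 \<in> subring_gen S"
| incl: "s \<in> S \<Longrightarrow> s \<in> subring_gen S"
| diff: "x \<in> subring_gen S \<Longrightarrow> y \<in> subring_gen S \<Longrightarrow> x - y \<in> subring_gen S"
| mult: "x \<in> subring_gen S \<Longrightarrow> y \<in> subring_gen S \<Longrightarrow> x * y \<in> subring_gen S"

lemma subring_gen_0: "0 \<in> subring_gen S"
  using subring_gen.diff[OF subring_gen.one subring_gen.one] by simp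

lemma subring_gen_mono: "S \<subseteq> T \<Longrightarrow> subring_gen S \<subseteq> subring_gen T"
proof
  fix x assume "x \<in> subring_gen S" "S \<subseteq> T"
  then show "x \<in> subring_gen T" by induction (auto intro: subring_gen.intros)
qed

lemma subring_gen_power: "x \<in> subring_gen S \<Longrightarrow> x ^ n \<in> subring_gen S"
  by (induction n) (auto intro: subring_gen.intros)

lemma zspan_subset_subring_gen: "set bs \<subseteq> subring_gen S \<Longrightarrow> zspan bs \<subseteq> subring_gen S"
  by (rule zspan_least) (auto intro: subring_gen.diff subring_gen_0)

text \<open>Stability is asked for on the right only and for the generators S only. Induction on the
  subring extends it to the right action of the whole subring, and acting on 1 then shows that the
  span is the subring (\<open>finite_span_closed_eq\<close>).\<close>

definition finite_span_closed :: "'r::ring_1 set \<Rightarrow> 'r list \<Rightarrow> bool" where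
  "finite_span_closed S bs \<longleftrightarrow>
     1 \<in> zspan bs \<and> set bs \<subseteq> subring_gen S \<and> (\<forall>m\<in>zspan bs. \<forall>s\<in>S. m * s \<in> zspan bs)"

lemma finite_span_closed_subring:
  assumes "finite_span_closed S bs" "z \<in> subring_gen S" "m \<in> zspan bs"
  shows "m * z \<in> zspan bs"
  using assms(2,3)
proof (induction arbitrary: m)
  case (mult x y)
  then show ?case by (simp flip: mult.assoc)
next
  case (incl s)
  with assms(1) show ?case by (auto simp: finite_span_closed_def)
qed (auto simp: right_diff_distrib intro: zspan_diff)

lemma finite_span_closed_eq:
  assumes "finite_span_closed S bs"
  shows "zspan bs = subring_gen S"
proof
  show "zspan bs \<subseteq> subring_gen S"
    using assms zspan_subset_subring_gen by (auto simp: finite_span_closed_def)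
  show "subring_gen S \<subseteq> zspan bs"
    using finite_span_closed_subring[OF assms, of _ 1] assms by (auto simp: finite_span_closed_def)
qed

definition products :: "'r::ring_1 list \<Rightarrow> 'r list \<Rightarrow> 'r list" where
  "products bs ps = concat (map (\<lambda>p. map (\<lambda>b. b * p) bs) ps)"

lemma set_products: "set (products bs ps) = {b * p | b p. b \<in> set bs \<and> p \<in> set ps}"
  by (auto simp: products_def)

lemma products_mult:
  assumes "x \<in> zspan bs" "y \<in> zspan ps"
  shows "x * y \<in> zspan (products bs ps)"
proof -
  have "x * p \<in> zspan (products bs ps)" if "p \<in> set ps" for p
    by (rule zspan_mult_right_closed[OF zspan_base assms(1)]) (use that in \<open>auto simp: set_products\<close>)
  then show ?thesis by (rule zspan_mult_left_closed) (use assms in auto)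
qed

text \<open>The span M of bs is enlarged to the sum of the groups M p for p in ps. The hypothesis
  \<open>step\<close> says that each generator, old or new, multiplies M p from the right into this
  sum. It is used with the powers of a central element and with the list of 1 and h.\<close>

lemma finite_span_closed_extend:
  assumes M: "finite_span_closed S bs" and 1: "1 \<in> zspan ps" and "S \<subseteq> S'" "set ps \<subseteq> subring_gen S'"
    and step: "\<And>p s m. p \<in> set ps \<Longrightarrow> s \<in> S' \<Longrightarrow> m \<in> zspan bs \<Longrightarrow> m * (p * s) \<in> zspan (products bs ps)"
  shows "finite_span_closed S' (products bs ps)"
  unfolding finite_span_closed_def
proof (intro conjI ballI)
  show "1 \<in> zspan (products bs ps)"
    using products_mult[of 1 bs 1 ps] M 1 by (auto simp: finite_span_closed_def)
  show "set (products bs ps) \<subseteq> subring_gen S'"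
    using M subring_gen_mono[OF assms(3)] assms(4)
    by (auto simp: set_products finite_span_closed_def intro!: subring_gen.mult)
  fix m s assume m: "m \<in> zspan (products bs ps)" and s: "s \<in> S'"
  show "m * s \<in> zspan (products bs ps)"
    using step[OF _ s zspan_base]
    by (intro zspan_mult_right_closed[OF _ m]) (auto simp: set_products mult.assoc)
qed

text \<open>An integral equation of degree n for t makes the powers below n suffice, and centrality
  lets the older generators pass through them.\<close>

lemma finite_span_closed_central:
  assumes M: "finite_span_closed S bs" and central: "\<And>y. t * y = y * t"
    and n: "n > 0" "t ^ n \<in> zspan (map ((^) t) [0..<n])"
  shows "\<exists>cs. finite_span_closed (insert t S) cs"
proof -
  let ?ps = "map ((^) t) [0..<n]"
  have pw: "t ^ k \<in> zspan ?ps" if "k \<le> n" for k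
    using that n by (cases "k = n") (auto intro: zspan_base)
  have c: "t ^ k * y = y * t ^ k" for k y by (metis central power_commuting_commutes)
  have "finite_span_closed (insert t S) (products bs ?ps)"
  proof (rule finite_span_closed_extend[OF M])
    show "1 \<in> zspan ?ps" using pw[of 0] by simp
    show "set ?ps \<subseteq> subring_gen (insert t S)" by (auto intro: subring_gen_power subring_gen.incl)
    fix p s m assume "p \<in> set ?ps" and s: "s \<in> insert t S" and m: "m \<in> zspan bs"
    then obtain k where k: "p = t ^ k" "k < n" by auto
    show "m * (p * s) \<in> zspan (products bs ?ps)"
    proof (cases "s = t")
      case True
      have "p * s = t ^ Suc k" by (simp add: True k c)
      then show ?thesis using products_mult[OF m pw[of "Suc k"]] k by simp
    next
      case False
      then have "m * s \<in> zspan bs" using M m s by (auto simp: finite_span_closed_def)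
      then have "(m * s) * t ^ k \<in> zspan (products bs ?ps)" using k by (intro products_mult pw) auto
      then show ?thesis by (simp add: k c mult.assoc)
    qed
  qed auto
  then show ?thesis by blast
qed

text \<open>The group M + M h is stable. The relation for h g + g h turns m h g into (m a) h + m b g
  + m c - (m g) h, where h is again on the far right; the relation for h h removes squares; central
  elements pass through h.\<close>

lemma finite_span_closed_anticommuting:
  assumes M: "finite_span_closed (T \<union> S) bs" and central: "\<And>y t. t \<in> T \<Longrightarrow> t * y = y * t"
    and sq: "a0 \<in> subring_gen T" "c0 \<in> subring_gen T" "h * h = a0 * h + c0"
    and comm: "\<And>g. g \<in> S \<Longrightarrow> \<exists>a b c. a \<in> subring_gen T \<and> b \<in> subring_gen T \<and> c \<in> subring_gen T \<and>
       h * g + g * h = a * h + b * g + c"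
  shows "\<exists>cs. finite_span_closed (T \<union> insert h S) cs"
proof -
  let ?ps = "[1, h]"
  have TS: "subring_gen T \<subseteq> subring_gen (T \<union> S)" by (rule subring_gen_mono) auto
  have mT: "m * z \<in> zspan bs" if "m \<in> zspan bs" "z \<in> subring_gen T" for m z
    using finite_span_closed_subring[OF M] that TS by blast
  have mS: "m * z \<in> zspan bs" if "m \<in> zspan bs" "z \<in> T \<union> S" for m z
    using finite_span_closed_subring[OF M] that subring_gen.incl by blast
  have P1: "m \<in> zspan (products bs ?ps)" if "m \<in> zspan bs" for m
    using products_mult[OF that zspan_base[of 1 ?ps]] by simp
  have Ph: "m * h \<in> zspan (products bs ?ps)" if "m \<in> zspan bs" for m
    using products_mult[OF that zspan_base[of h ?ps]] by simp
  have "finite_span_closed (T \<union> insert h S) (products bs ?ps)"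
  proof (rule finite_span_closed_extend[OF M])
    show "1 \<in> zspan ?ps" by (rule zspan_base) simp
    show "set ?ps \<subseteq> subring_gen (T \<union> insert h S)" by (auto intro: subring_gen.intros)
    fix p s m assume p: "p \<in> set ?ps" and s: "s \<in> T \<union> insert h S" and m: "m \<in> zspan bs"
    consider "p = 1" "s = h" | "p = 1" "s \<in> T \<union> S" | "p = h" "s = h" | "p = h" "s \<in> T" | "p = h" "s \<in> S"
      using p s by auto
    then show "m * (p * s) \<in> zspan (products bs ?ps)"
    proof cases
      case 1
      then show ?thesis using Ph[OF m] by simp
    next
      case 2
      then show ?thesis using P1[OF mS[OF m]] by simp
    next
      case 3
      have "m * (p * s) = (m * a0) * h + m * c0" using 3 sq by (simp add: distrib_left mult.assoc)
      then show ?thesis using P1[OF mT[OF m sq(2)]] Ph[OF mT[OF m sq(1)]] by (simp add: zspan_add)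
    next
      case 4
      have "m * (p * s) = (m * s) * h" using 4 central[of s h] by (simp add: mult.assoc)
      then show ?thesis using mS[OF m] 4 by (auto intro!: Ph)
    next
      case 5
      then obtain a b c where abc: "a \<in> subring_gen T" "b \<in> subring_gen T" "c \<in> subring_gen T"
        "h * s + s * h = a * h + b * s + c" using comm by blast
      then have "h * s = a * h + b * s + c - s * h" by (simp add: eq_diff_eq)
      then have "m * (p * s) = (m * a) * h + (m * b) * s + m * c - (m * s) * h"
        using 5 by (simp add: distrib_left right_diff_distrib mult.assoc)
      moreover have "m * b * s \<in> zspan bs" "m * s \<in> zspan bs"
        using 5 mS[OF mT[OF m abc(2)]] mS[OF m] by auto
      ultimately show ?thesis
        using zspan_diff[OF zspan_add[OF zspan_add[OF Ph[OF mT] P1] P1[OF mT]] Ph] m abc by simp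
    qed
  qed auto
  then show ?thesis by blast
qed

section \<open>Two-by-two matrices and torsion groups\<close>

text \<open>A type of its own, so that \<open>*\<close> and \<open>^\<close> are the matrix
  operations and the results on \<open>ring_1\<close> apply.\<close>

datatype 'a mat2 = Mat2 'a 'a 'a 'a

instantiation mat2 :: (comm_ring_1) ring_1
begin

definition "0 = Mat2 0 0 0 0"
definition "1 = Mat2 1 0 0 1"
fun plus_mat2 where "Mat2 a b c d + Mat2 a' b' c' d' = Mat2 (a + a') (b + b') (c + c') (d + d')"
fun minus_mat2 where "Mat2 a b c d - Mat2 a' b' c' d' = Mat2 (a - a') (b - b') (c - c') (d - d')"
fun uminus_mat2 where "- Mat2 a b c d = Mat2 (- a) (- b) (- c) (- d)"
fun times_mat2 where "Mat2 a b c d * Mat2 a' b' c' d' =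
  Mat2 (a * a' + b * c') (a * b' + b * d') (c * a' + d * c') (c * b' + d * d')"

instance
proof
  fix a b c :: "'a mat2"
  show "a + b + c = a + (b + c)" by (cases a; cases b; cases c) (simp add: algebra_simps)
  show "a + b = b + a" by (cases a; cases b) (simp add: algebra_simps)
  show "0 + a = a" by (cases a) (simp add: zero_mat2_def)
  show "- a + a = 0" by (cases a) (simp add: zero_mat2_def)
  show "a - b = a + - b" by (cases a; cases b) simp
  show "a * b * c = a * (b * c)" by (cases a; cases b; cases c) (simp add: algebra_simps)
  show "(a + b) * c = a * c + b * c" by (cases a; cases b; cases c) (simp add: algebra_simps)
  show "a * (b + c) = a * b + a * c" by (cases a; cases b; cases c) (simp add: algebra_simps)
  show "1 * a = a" "a * 1 = a" by (cases a, simp add: one_mat2_def)+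
  show "0 \<noteq> (1 :: 'a mat2)" by (simp add: zero_mat2_def one_mat2_def)
qed

end

section \<open>Trace, determinant and adjugate\<close>

fun tr2 :: "'a::comm_ring_1 mat2 \<Rightarrow> 'a" where "tr2 (Mat2 a b c d) = a + d"
fun det2 :: "'a::comm_ring_1 mat2 \<Rightarrow> 'a" where "det2 (Mat2 a b c d) = a * d - b * c"
fun adj2 :: "'a::comm_ring_1 mat2 \<Rightarrow> 'a mat2" where "adj2 (Mat2 a b c d) = Mat2 d (- b) (- c) a"
text \<open>Scalars are viewed as matrices so that traces are elements of the very ring in which
  \<open>zspan\<close> and \<open>subring_gen\<close> are formed.\<close>

definition scal :: "'a::comm_ring_1 \<Rightarrow> 'a mat2" where "scal c = Mat2 c 0 0 c"

lemma scal_0: "scal 0 = 0" and scal_1: "scal 1 = 1"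
  and scal_add: "scal (a + b) = scal a + scal b"
  and scal_diff: "scal (a - b) = scal a - scal b"
  and scal_mult: "scal (a * b) = scal a * scal b"
  by (simp_all add: scal_def zero_mat2_def one_mat2_def)

lemma scal_inject: "scal a = scal b \<longleftrightarrow> a = b" by (simp add: scal_def)

lemma scal_of_nat: "scal (of_nat n) = of_nat n"
  by (induction n) (simp_all add: scal_0 scal_1 scal_add)

lemma scal_of_int: "scal (of_int k) = of_int k"
  by (cases k rule: int_cases2) (simp_all add: scal_of_nat scal_0 flip: diff_0 add: scal_diff)

lemma scal_central: "scal c * A = A * scal c"
  by (cases A) (simp add: scal_def algebra_simps)

lemma scal_eq_0_mult: "scal (c :: 'a::field) * A = 0 \<longleftrightarrow> c = 0 \<or> A = 0"
  by (cases A) (auto simp: scal_def zero_mat2_def)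

lemma det2_1: "det2 1 = 1" by (simp add: one_mat2_def)

lemma det2_mult: "det2 (A * B) = det2 A * det2 B"
  by (cases A; cases B) (simp add: algebra_simps)

lemma det2_scal: "det2 (scal c) = c * c" by (simp add: scal_def)

lemma adj2_mult: "adj2 A * A = scal (det2 A)" "A * adj2 A = scal (det2 A)"
  by (cases A, simp add: scal_def algebra_simps)+

lemma add_adj2: "A + adj2 A = scal (tr2 A)"
  by (cases A) (simp add: scal_def)

text \<open>This is the Cayley-Hamilton theorem.\<close>

lemma mat2_square: "A * A = scal (tr2 A) * A - scal (det2 A)"
  by (cases A) (simp add: scal_def algebra_simps)

text \<open>Cayley-Hamilton polarized: it is applied to A + B, and the mixed term of the determinant
  is tr(A) tr(B) - tr(A B).\<close>

lemma mat2_anticommutator: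
  "A * B + B * A = scal (tr2 B) * A + scal (tr2 A) * B + scal (tr2 (A * B) - tr2 A * tr2 B)"
  by (cases A; cases B) (simp add: scal_def algebra_simps)

text \<open>The adjugate is the inverse of A, so \<open>u k\<close> is A^k + A^(-k). Its recursion
  makes it a monic integer polynomial of degree k in t, a rescaled Chebyshev polynomial, and A^n = 1
  gives u n = 2: this is the integral equation for t.\<close>

lemma trace_integral:
  assumes det: "det2 A = 1" and n: "A ^ n = 1" "n > 0"
  shows "scal (tr2 A) ^ n \<in> zspan (map ((^) (scal (tr2 A))) [0..<n])"
proof -
  define t where "t = scal (tr2 A)"
  define u where "u k = A ^ k + adj2 A ^ k" for k
  let ?Z = "\<lambda>k. zspan (map ((^) t) [0..<k])"
  have inv: "A * adj2 A = 1" "adj2 A * A = 1" by (simp_all add: adj2_mult det scal_1)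
  have t: "t = A + adj2 A" by (simp add: t_def add_adj2)
  have rec: "u (Suc (Suc k)) = t * u (Suc k) - u k" for k
  proof -
    have "A * adj2 A ^ Suc k = adj2 A ^ k" "adj2 A * A ^ Suc k = A ^ k"
      using inv by (simp_all flip: mult.assoc)
    then show ?thesis by (simp add: u_def t distrib_left distrib_right del: power_Suc) (simp add: algebra_simps)
  qed
  have pw: "t ^ j \<in> ?Z k" if "j < k" for j k using that by (auto intro: zspan_base)
  have mono: "?Z j \<subseteq> ?Z k" if "j \<le> k" for j k using that by (intro zspan_mono) auto
  have mt: "t * x \<in> ?Z (Suc k)" if "x \<in> ?Z k" for x k
    by (rule zspan_mult_left_closed[OF _ that]) (use pw[of "Suc _" "Suc k"] in auto)
  \<comment> \<open>Two consecutive degrees are needed for a recursion of order two. They start at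
    1, since u 0 = 2 and t^0 - u 0 = -1 is not in \<open>?Z 0\<close>, which is zero.\<close>
  have "t ^ Suc k - u (Suc k) \<in> ?Z (Suc k) \<and> t ^ Suc (Suc k) - u (Suc (Suc k)) \<in> ?Z (Suc (Suc k))" for k
  proof (induction k)
    case 0
    have 1: "1 \<in> ?Z 2" using pw[of 0 2] by simp
    have "t ^ 2 - u 2 = 1 + 1" unfolding t u_def power2_eq_square using inv by (simp add: algebra_simps)
    then have "t ^ 2 - u 2 \<in> ?Z 2" using zspan_add[OF 1 1] by simp
    moreover have "t ^ 1 - u 1 = 0" by (simp add: u_def t)
    then have "t ^ 1 - u 1 \<in> ?Z 1" using zspan_0 by metis
    ultimately show ?case by (simp add: numeral_2_eq_2)
  next
    case (Suc k)
    have "t ^ Suc (Suc (Suc k)) - u (Suc (Suc (Suc k)))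
      = t * (t ^ Suc (Suc k) - u (Suc (Suc k))) + (t ^ Suc k - (t ^ Suc k - u (Suc k)))"
      unfolding rec[of "Suc k"] by (simp add: right_diff_distrib)
    also have "\<dots> \<in> ?Z (Suc (Suc (Suc k)))"
    proof (rule zspan_add)
      show "t * (t ^ Suc (Suc k) - u (Suc (Suc k))) \<in> ?Z (Suc (Suc (Suc k)))" using Suc by (blast intro: mt)
      show "t ^ Suc k - (t ^ Suc k - u (Suc k)) \<in> ?Z (Suc (Suc (Suc k)))"
      proof (rule zspan_diff)
        show "t ^ Suc k \<in> ?Z (Suc (Suc (Suc k)))" by (rule pw) simp
        show "t ^ Suc k - u (Suc k) \<in> ?Z (Suc (Suc (Suc k)))"
          using Suc mono[of "Suc k" "Suc (Suc (Suc k))"] by (meson subsetD conjunct1 le_Suc_eq le_refl)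
      qed
    qed
    finally show ?case using Suc by blast
  qed
  from this[of "n - 1"] n(2) have "t ^ n - u n \<in> ?Z n" by simp
  moreover have "u n = 1 + 1"
  proof -
    have "A ^ k * adj2 A ^ k = 1" for k
    proof (induction k)
      case (Suc k)
      have "A ^ Suc k * adj2 A ^ Suc k = A ^ k * (A * adj2 A) * adj2 A ^ k"
        by (simp only: power_Suc2[of A] power_Suc[of "adj2 A"] mult.assoc)
      then show ?case using Suc inv by simp
    qed simp
    from this[of n] show ?thesis using n by (simp add: u_def)
  qed
  moreover have "1 \<in> ?Z n" using pw[of 0 n] n by simp
  ultimately have "(t ^ n - u n) + (1 + 1) \<in> ?Z n" by (intro zspan_add) auto
  then show ?thesis unfolding t_def[symmetric] using \<open>u n = 1 + 1\<close> by simp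
qed

lemma geometric_sum_mult: "(x - 1) * (\<Sum>i<n. x ^ i) = x ^ n - (1 :: 'r::ring_1)"
  by (induction n) (simp_all add: distrib_left left_diff_distrib)

lemma mat2_char_0:
  assumes "CHAR('a::comm_ring_1) = 0" "of_int k = (0 :: 'a mat2)"
  shows "k = 0"
proof -
  have "of_int k = (0 :: 'a)" using assms(2) by (simp flip: scal_of_int scal_0 add: scal_inject)
  then have "int CHAR('a) dvd k" by (simp add: of_int_eq_0_iff_char_dvd)
  then show ?thesis using assms by simp
qed

lemma of_nat_mult_mat2_eq_0:
  assumes "CHAR('a::field) = 0" "n > 0" "of_nat n * (A :: 'a mat2) = 0"
  shows "A = 0"
proof -
  have "(of_nat n :: 'a) \<noteq> 0" using assms by (simp add: of_nat_eq_0_iff_char_dvd)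
  then show ?thesis using assms by (simp flip: scal_of_nat add: scal_eq_0_mult)
qed

text \<open>For determinant 1, Cayley-Hamilton reads (A - 1)^2 = (tr(A) - 2) A. If the trace is not
  2, then A - 1 is invertible and cancels from (A - 1)(1 + ... + A^(n-1)) = A^n - 1 = 0. If it is 2,
  then A^n = 1 + n (A - 1), which in characteristic 0 equals 1 only for A = 1.\<close>

lemma torsion_sum_powers:
  fixes A :: "'a::field mat2"
  assumes char: "CHAR('a) = 0" and det: "det2 A = 1" and n: "A ^ n = 1" "n > 0" and "A \<noteq> 1"
  shows "(\<Sum>i<n. A ^ i) = 0"
proof -
  have sq: "(A - 1) * (A - 1) = scal (tr2 A - 2) * A"
  proof -
    have "scal 2 * A = A + A" using scal_add[of "1 :: 'a" 1] by (simp add: scal_1 mult_2)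
    then show ?thesis using mat2_square[of A] by (simp add: det algebra_simps scal_diff scal_1)
  qed
  have "tr2 A \<noteq> 2"
  proof
    assume "tr2 A = 2"
    then have y: "(A - 1) * (A - 1) = 0" using sq by (simp add: scal_0)
    have "A ^ k = 1 + of_nat k * (A - 1)" for k
    proof (induction k)
      case (Suc k)
      have "A ^ Suc k = A * A ^ k" by simp
      also have "\<dots> = (1 + (A - 1)) * (1 + of_nat k * (A - 1))" by (simp add: Suc)
      also have "\<dots> = 1 + (A - 1) + of_nat k * (A - 1) + of_nat k * ((A - 1) * (A - 1))"
        unfolding distrib_right distrib_left mult_1 mult_1_right
        by (simp only: mult_of_nat_commute mult.assoc add.assoc)
      also have "\<dots> = 1 + of_nat (Suc k) * (A - 1)" unfolding y by (simp add: algebra_simps)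
      finally show ?case .
    qed simp
    from this[of n] have "of_nat n * (A - 1) = 0" using n by simp
    then have "A - 1 = 0" by (rule of_nat_mult_mat2_eq_0[OF char n(2)])
    with assms show False by simp
  qed
  moreover have "scal (tr2 A - 2) * (A * (\<Sum>i<n. A ^ i)) = 0"
  proof -
    have "scal (tr2 A - 2) * (A * (\<Sum>i<n. A ^ i)) = (A - 1) * ((A - 1) * (\<Sum>i<n. A ^ i))"
      by (simp only: sq flip: mult.assoc)
    then show ?thesis by (simp add: geometric_sum_mult n)
  qed
  ultimately have "A * (\<Sum>i<n. A ^ i) = 0" by (simp add: scal_eq_0_mult)
  then have "adj2 A * A * (\<Sum>i<n. A ^ i) = 0" by (simp add: mult.assoc)
  then show ?thesis by (simp add: adj2_mult det scal_1)
qed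

section \<open>Finitely generated torsion monoids in SL_2\<close>

inductive_set submonoid_gen :: "'r::monoid_mult set \<Rightarrow> 'r set" for S where
  one: "1 \<in> submonoid_gen S"
| mult: "s \<in> S \<Longrightarrow> x \<in> submonoid_gen S \<Longrightarrow> s * x \<in> submonoid_gen S"

lemma submonoid_gen_incl: "s \<in> S \<Longrightarrow> s \<in> submonoid_gen S"
  using submonoid_gen.mult[OF _ submonoid_gen.one] by fastforce

lemma submonoid_gen_mult: "x \<in> submonoid_gen S \<Longrightarrow> y \<in> submonoid_gen S \<Longrightarrow> x * y \<in> submonoid_gen S"
  by (induction rule: submonoid_gen.induct) (auto simp: mult.assoc intro: submonoid_gen.intros)

lemma submonoid_gen_power: "x \<in> submonoid_gen S \<Longrightarrow> x ^ n \<in> submonoid_gen S"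
  by (induction n) (auto intro: submonoid_gen_mult submonoid_gen.one)

lemma submonoid_gen_subset_subring_gen: "submonoid_gen S \<subseteq> subring_gen S"
proof
  fix x assume "x \<in> submonoid_gen S"
  then show "x \<in> subring_gen S" by induction (auto intro: subring_gen.intros)
qed

text \<open>The multiplicative span of the generators is finite over the ring of traces because two
  generators anticommute up to terms of lower degree with traces as coefficients.\<close>

lemma torsion_mat2_finite_span:
  fixes S :: "'a::field mat2 set"
  assumes fin: "finite S" and det: "\<And>A. A \<in> S \<Longrightarrow> det2 A = 1"
    and torsion: "\<And>A. A \<in> submonoid_gen S \<Longrightarrow> \<exists>n>0. A ^ n = 1"
  shows "\<exists>R bs. finite_span_closed (R \<union> S) bs"
proof -
  \<comment> \<open>These are the traces in \<open>mat2_square\<close> and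
    \<open>mat2_anticommutator\<close> for elements of S. Products of two generators lie in the
    monoid as well, so all of these traces belong to torsion elements and are integral.\<close>
  define R where "R = (\<lambda>A. scal (tr2 A)) ` (S \<union> (\<lambda>(A, B). A * B) ` (S \<times> S))"
  have "\<exists>cs. finite_span_closed U cs" if "finite U" "U \<subseteq> R" for U
    using that
  proof (induction rule: finite_induct)
    case empty
    have "finite_span_closed {} [1 :: 'a mat2]"
      using zspan_base[of 1 "[1 :: 'a mat2]"] by (simp add: finite_span_closed_def subring_gen.one)
    then show ?case by blast
  next
    case (insert t U)
    then obtain cs where cs: "finite_span_closed U cs" by auto
    from insert obtain A where A: "t = scal (tr2 A)" "A \<in> S \<union> (\<lambda>(A, B). A * B) ` (S \<times> S)"
      by (auto simp: R_def)
    then have "det2 A = 1" "A \<in> submonoid_gen S"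
      by (auto simp: det2_mult det intro: submonoid_gen_incl submonoid_gen_mult)
    then obtain n where "n > 0" "t ^ n \<in> zspan (map ((^) t) [0..<n])"
      using trace_integral torsion A by blast
    then show ?case using finite_span_closed_central[OF cs] A scal_central by blast
  qed
  moreover have "finite R" using fin by (simp add: R_def)
  ultimately obtain cs where "finite_span_closed R cs" by blast
  moreover have "\<exists>bs. finite_span_closed (R \<union> U) bs" if "finite U" "U \<subseteq> S" "finite_span_closed R cs" for U
    using that
  proof (induction rule: finite_induct)
    case empty
    then show ?case by auto
  next
    case (insert h U)
    then obtain bs where bs: "finite_span_closed (R \<union> U) bs" by auto
    have h: "h \<in> S" using insert by auto
    have tr: "scal (tr2 A) \<in> subring_gen R" if "A \<in> S" for A
      using that by (auto simp: R_def intro!: subring_gen.incl)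
    have trm: "scal (tr2 (A * B)) \<in> subring_gen R" if "A \<in> S" "B \<in> S" for A B
      using that by (force simp: R_def intro!: subring_gen.incl)
    have "\<exists>cs. finite_span_closed (R \<union> insert h U) cs"
    proof (rule finite_span_closed_anticommuting[OF bs])
      show "t * y = y * t" if "t \<in> R" for t y using that scal_central by (auto simp: R_def)
      show "scal (tr2 h) \<in> subring_gen R" using h tr by blast
      show "0 - 1 \<in> subring_gen R" by (intro subring_gen.intros subring_gen_0)
      show "h * h = scal (tr2 h) * h + (0 - 1)" using mat2_square[of h] det[OF h] by (simp add: scal_1)
      fix g assume "g \<in> U"
      then have g: "g \<in> S" using insert by auto
      have "scal (tr2 (h * g) - tr2 h * tr2 g) \<in> subring_gen R"
        unfolding scal_diff scal_mult by (intro subring_gen.diff subring_gen.mult tr trm h g)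
      then show "\<exists>a b c. a \<in> subring_gen R \<and> b \<in> subring_gen R \<and> c \<in> subring_gen R \<and>
          h * g + g * h = a * h + b * g + c"
        using tr[OF h] tr[OF g] mat2_anticommutator[of h g] by blast
    qed
    then show ?case .
  qed
  ultimately show ?thesis using fin by blast
qed

text \<open>Minkowski's argument: if \<open>A\<close> had order \<open>d > 1\<close>, its powers would add up to 0, so \<open>d\<close> would be a
  multiple of 4 in the ring; replacing \<open>A\<close> by \<open>A ^ (d div 2)\<close> if \<open>d\<close> is even, the ring would contain 1/2.\<close>

lemma torsion_congruent_one:
  fixes A :: "'a::field mat2"
  assumes char: "CHAR('a) = 0" and M: "finite_span_closed S bs"
    and A: "A \<in> zspan bs" "det2 A = 1" "A ^ n = 1" "n > 0"
    and x: "x \<in> zspan bs" "A = 1 + 4 * x"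
  shows "A = 1"
proof (rule ccontr)
  assume "A \<noteq> 1"
  have one: "1 \<in> zspan bs" using M by (simp add: finite_span_closed_def)
  have mult: "a * b \<in> zspan bs" if "a \<in> zspan bs" "b \<in> zspan bs" for a b
    using that unfolding finite_span_closed_eq[OF M] by (rule subring_gen.mult)
  have half: "1 + (y + y) \<noteq> 0" if "y \<in> zspan bs" for y
  proof
    assume "1 + (y + y) = 0"
    then have "- y + - y = 1" by (metis eq_neg_iff_add_eq_0 minus_add_distrib)
    then show False
      using half_notin_zspan_ring[OF mat2_char_0[OF char] one mult zspan_uminus[OF that]] by blast
  qed
  have pow: "\<exists>y\<in>zspan bs. A ^ k = 1 + 4 * y" for k
  proof (induction k)
    case 0
    then show ?case using zspan_0 by (intro bexI[of _ 0]) auto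
  next
    case (Suc k)
    then obtain y where y: "y \<in> zspan bs" "A ^ k = 1 + 4 * y" by auto
    have "A ^ Suc k = (1 + 4 * y) * A" by (simp add: power_commutes y(2)[symmetric])
    also have "\<dots> = 1 + 4 * x + 4 * (y * A)" unfolding distrib_right mult.assoc x(2)[symmetric] by simp
    finally have "A ^ Suc k = 1 + 4 * (x + y * A)" by (simp only: distrib_left add.assoc)
    then show ?case using zspan_add[OF x(1) mult[OF y(1) A(1)]] by blast
  qed
  define d where "d = (LEAST d. d > 0 \<and> A ^ d = 1)"
  have d: "d > 0" "A ^ d = 1" using LeastI[of "\<lambda>d. d > 0 \<and> A ^ d = 1" n] A unfolding d_def by auto
  have min: "d \<le> e" if "e > 0" "A ^ e = 1" for e using that unfolding d_def by (intro Least_le) auto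
  show False
  proof (cases "even d")
    case True
    then obtain e where e: "d = e + e" by (metis evenE mult_2)
    define B where "B = A ^ e"
    have "B \<noteq> 1" using min[of e] d e by (auto simp: B_def)
    moreover have "B ^ 2 = 1" using d by (simp add: B_def e power2_eq_square power_add)
    moreover have "det2 B = 1" unfolding B_def by (induction e) (simp_all add: det2_1 det2_mult A)
    ultimately have "(\<Sum>i<2. B ^ i) = 0" by (intro torsion_sum_powers char) auto
    then have "1 + B = 0" by (simp add: numeral_2_eq_2)
    moreover obtain y where y: "y \<in> zspan bs" "B = 1 + 4 * y" using pow B_def by blast
    \<comment> \<open>Here the modulus 4 is decisive: 1 + B is 2 (1 + 2y), and after division by 2
      an odd element remains. With B = 1 + 2y, the equation 1 + B = 0 would just say y = -1.\<close>
    moreover have "of_nat 2 * (1 + 2 * y) = 1 + (1 + 4 * y)"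
      by (simp add: distrib_left flip: mult.assoc add.assoc)
    ultimately have "of_nat 2 * (1 + 2 * y) = 0" by simp
    then have "1 + 2 * y = 0" by (rule of_nat_mult_mat2_eq_0[OF char, rotated]) simp
    then show False using half y by (simp add: mult_2)
  next
    case False
    then obtain j where j: "d = j + j + 1" by (metis oddE mult_2)
    have "\<exists>y\<in>zspan bs. (\<Sum>i<k. A ^ i) = of_nat k + 4 * y" for k
    proof (induction k)
      case 0
      then show ?case using zspan_0 by (intro bexI[of _ 0]) auto
    next
      case (Suc k)
      then obtain y where y: "y \<in> zspan bs" "(\<Sum>i<k. A ^ i) = of_nat k + 4 * y" by auto
      obtain z where z: "z \<in> zspan bs" "A ^ k = 1 + 4 * z" using pow by blast
      show ?case using y z by (intro bexI[of _ "y + z"] zspan_add) (auto simp: distrib_left)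
    qed
    then obtain y where y: "y \<in> zspan bs" "of_nat d + 4 * y = 0"
      using torsion_sum_powers[OF char A(2) d(2,1) \<open>A \<noteq> 1\<close>] by metis
    have "4 * y = 2 * (2 * y)" by (simp flip: mult.assoc)
    then have "4 * y = (y + y) + (y + y)" by (simp only: mult_2)
    \<comment> \<open>The equation d + 4y = 0 with d = 2j + 1, written as 1 + 2 (j + 2y) =
      0.\<close>
    then have "1 + ((of_nat j * 1 + (y + y)) + (of_nat j * 1 + (y + y))) = 0"
      using y(2) by (simp add: j mult_2 ac_simps)
    moreover have "of_nat j * 1 + (y + y) \<in> zspan bs"
      using y one by (intro zspan_add zspan_of_nat)
    ultimately show False using half by blast
  qed
qed

text \<open>Schur's theorem on finitely generated torsion linear groups, in the case of SL_2. It is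
  stated for monoids because an inverse in a torsion monoid is a power.\<close>

theorem finite_torsion_submonoid_SL2:
  fixes S :: "'a::field mat2 set"
  assumes fin: "finite S" and det: "\<And>A. A \<in> S \<Longrightarrow> det2 A = 1"
    and torsion: "\<And>A. A \<in> submonoid_gen S \<Longrightarrow> \<exists>n>0. A ^ n = 1"
  shows "finite (submonoid_gen S)"
proof -
  let ?G = "submonoid_gen S"
  obtain R bs where M: "finite_span_closed (R \<union> S) bs" using torsion_mat2_finite_span[OF assms] by blast
  have eq: "zspan bs = subring_gen (R \<union> S)" using M by (rule finite_span_closed_eq)
  have G: "?G \<subseteq> zspan bs"
    unfolding eq using submonoid_gen_subset_subring_gen subring_gen_mono[of S "R \<union> S"] by blast
  show ?thesis
  proof (cases "CHAR('a) = 0")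
    case False
    define p where "p = CHAR('a)"
    have p: "p > 0" "of_nat p = (0 :: 'a mat2)"
      using False by (simp_all add: p_def flip: scal_of_nat) (simp add: scal_0)
    obtain F where "finite F" "\<forall>m\<in>zspan bs. \<exists>f\<in>F. \<exists>m'\<in>zspan bs. m = f + of_nat p * m'"
      using zspan_residues[OF p(1), of bs] by blast
    then have "zspan bs \<subseteq> F" by (auto simp: p)
    then show ?thesis using finite_subset[OF order.trans[OF G]] \<open>finite F\<close> by simp
  next
    case True
    obtain F where F: "finite F" "\<forall>m\<in>zspan bs. \<exists>f\<in>F. \<exists>m'\<in>zspan bs. m = f + of_nat 4 * m'"
      using zspan_residues[of 4 bs, OF zero_less_numeral] by blast
    then have "\<forall>m\<in>?G. \<exists>f. f \<in> F \<and> (\<exists>m'\<in>zspan bs. m = f + of_nat 4 * m')" using G by blast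
    then obtain r where r: "\<And>m. m \<in> ?G \<Longrightarrow> r m \<in> F \<and> (\<exists>m'\<in>zspan bs. m = r m + of_nat 4 * m')" by metis
    have detG: "det2 A = 1" if "A \<in> ?G" for A
      using that by induction (simp_all add: det2_1 det2_mult det)
    have "inj_on r ?G"
    proof
      fix A B assume A: "A \<in> ?G" and B: "B \<in> ?G" and AB: "r A = r B"
      obtain a where a: "a \<in> zspan bs" "A = r A + 4 * a" using r[OF A] by auto
      obtain b where b: "b \<in> zspan bs" "B = r B + 4 * b" using r[OF B] by auto
      have "A - B = 4 * (a - b)" using a(2) b(2) AB by (metis add_diff_cancel_left right_diff_distrib)
      obtain n where n: "n > 0" "B ^ n = 1" using torsion[OF B] by blast
      \<comment> \<open>The inverse of B, as a power, so that the quotient A B' remains in the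
        monoid and is torsion. Equal residues of A and B make this quotient congruent to 1 modulo
        4.\<close>
      define B' where "B' = B ^ (n - 1)"
      have B': "B * B' = 1" "B' * B = 1"
        using n by (simp_all add: B'_def flip: power_Suc power_Suc2)
      have B'G: "B' \<in> ?G" unfolding B'_def using B by (rule submonoid_gen_power)
      have AB': "A * B' \<in> ?G" using A B'G by (rule submonoid_gen_mult)
      then obtain k where k: "k > 0" "(A * B') ^ k = 1" using torsion by blast
      have "A * B' = 1 + (A - B) * B'" by (simp add: left_diff_distrib B')
      also have "\<dots> = 1 + 4 * ((a - b) * B')" by (simp only: \<open>A - B = 4 * (a - b)\<close> mult.assoc)
      finally have eq1: "A * B' = 1 + 4 * ((a - b) * B')" .
      have "(a - b) * B' \<in> zspan bs"
        using zspan_diff[OF a(1) b(1)] B'G G unfolding eq by (blast intro: subring_gen.mult)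
      then have "A * B' = 1"
        using torsion_congruent_one[OF True M _ detG[OF AB'] k(2,1) _ eq1] AB' G by blast
      then have "A * B' * B = B" by simp
      then show "A = B" by (simp add: mult.assoc B')
    qed
    moreover have "r ` ?G \<subseteq> F" using r by auto
    ultimately show ?thesis using F(1) finite_subset inj_on_finite by blast
  qed
qed

section \<open>Arrows as matrices and base change\<close>

definition map_vec :: "('a \<Rightarrow> 'b) \<Rightarrow> 'a ^ 'n \<Rightarrow> 'b ^ 'n" where
  "map_vec h v = (\<chi> i. h (v $ i))"

definition map_mat :: "('a \<Rightarrow> 'b) \<Rightarrow> 'a ^ 'n ^ 'm \<Rightarrow> 'b ^ 'n ^ 'm" where
  "map_mat h A = (\<chi> i j. h (A $ i $ j))"

lemma base_change_eq: "base_change h L = vec.span (map_vec h ` L)"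
  by (simp add: base_change_def map_vec_def)

section \<open>Extension of scalars for vectors and subspaces\<close>

locale field_ext =
  fixes h :: "'a::field \<Rightarrow> 'b::field"
  assumes ext: "field_extension h"
begin

lemma hom_add: "h (x + y) = h x + h y" and hom_mult: "h (x * y) = h x * h y" and hom_1: "h 1 = 1"
  using ext by (simp_all add: field_extension_def)

lemma hom_0: "h 0 = 0"
  using hom_add[of 0 0] by (metis add_0 add_cancel_right_right)

lemma hom_minus: "h (- x) = - h x"
  using hom_add[of x "- x"] by (simp add: hom_0 eq_neg_iff_add_eq_0 add.commute)

lemma hom_diff: "h (x - y) = h x - h y"
  using hom_add[of x "- y"] by (simp add: hom_minus)

lemma hom_eq_0: "h x = 0 \<longleftrightarrow> x = 0"
proof
  assume "h x = 0"
  show "x = 0"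
  proof (rule ccontr)
    assume "x \<noteq> 0"
    then have "h x * h (inverse x) = 1" by (simp add: hom_1 flip: hom_mult)
    with \<open>h x = 0\<close> show False by simp
  qed
qed (simp add: hom_0)

lemma hom_inject: "h x = h y \<longleftrightarrow> x = y"
  using hom_eq_0[of "x - y"] by (simp add: hom_diff)

lemma hom_sum: "h (\<Sum>i\<in>S. f i) = (\<Sum>i\<in>S. h (f i))"
  by (induction S rule: infinite_finite_induct) (simp_all add: hom_0 hom_add)

lemma map_vec_0: "map_vec h 0 = 0"
  and map_vec_add: "map_vec h (u + v) = map_vec h u + map_vec h v"
  and map_vec_scale: "map_vec h (c *s v) = h c *s map_vec h v"
  by (simp_all add: map_vec_def vec_eq_iff hom_0 hom_add hom_mult)

lemma map_vec_inject: "map_vec h u = map_vec h v \<longleftrightarrow> u = v"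
  by (simp add: map_vec_def vec_eq_iff hom_inject)

lemma map_vec_eq_0: "map_vec h v = 0 \<longleftrightarrow> v = 0"
  using map_vec_inject[of v 0] by (simp add: map_vec_0)

lemma map_mat_mult_vec: "map_mat h A *v map_vec h v = map_vec h (A *v v)"
  by (simp add: map_vec_def map_mat_def matrix_vector_mult_def vec_eq_iff hom_sum hom_mult)

lemma map_mat_mult: "map_mat h (A ** B) = map_mat h A ** map_mat h B"
  by (simp add: map_mat_def matrix_matrix_mult_def vec_eq_iff hom_sum hom_mult)

lemma map_mat_1: "map_mat h (mat 1) = mat 1"
  by (simp add: map_mat_def mat_def vec_eq_iff hom_0 hom_1)

text \<open>The factor can be read off at a coordinate where v does not vanish, as a quotient of
  elements of the small field. By this, equality of maps between lines descends.\<close>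

lemma map_vec_proportional:
  assumes "map_vec h u = c *s map_vec h v" "v \<noteq> 0"
  shows "\<exists>d. u = d *s v"
proof -
  obtain i where i: "v $ i \<noteq> 0" using assms(2) by (auto simp: vec_eq_iff)
  define d where "d = u $ i / v $ i"
  have "h (u $ j) = c * h (v $ j)" for j
    using assms(1) by (auto simp: map_vec_def vec_eq_iff)
  moreover from this[of i] have "c = h d"
  proof -
    have "h d * h (v $ i) = c * h (v $ i)"
      using i \<open>h (u $ i) = c * h (v $ i)\<close> by (simp add: d_def flip: hom_mult)
    then show ?thesis using i by (simp add: hom_eq_0)
  qed
  ultimately have "u = d *s v" by (simp add: vec_eq_iff hom_inject flip: hom_mult)
  then show ?thesis ..
qed

lemma base_change_least:
  assumes "\<And>v. v \<in> L \<Longrightarrow> map_vec h v \<in> V" "vec.subspace V"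
  shows "base_change h L \<subseteq> V"
  unfolding base_change_eq using assms by (intro vec.span_minimal) auto

lemma map_vec_in_base_change: "v \<in> L \<Longrightarrow> map_vec h v \<in> base_change h L"
  by (auto simp: base_change_eq intro: vec.span_base)

lemma subspace_base_change: "vec.subspace (base_change h L)"
  by (simp add: base_change_eq vec.subspace_span)

lemma base_change_span: "base_change h (vec.span B) = vec.span (map_vec h ` B)"
proof
  have "vec.span B \<subseteq> {v. map_vec h v \<in> vec.span (map_vec h ` B)}"
    by (rule vec.span_minimal)
       (auto simp: vec.subspace_def map_vec_0 map_vec_add map_vec_scale
         intro: vec.span_base vec.span_zero vec.span_add vec.span_scale)
  then show "base_change h (vec.span B) \<subseteq> vec.span (map_vec h ` B)"
    by (intro base_change_least) (auto simp: vec.subspace_span)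
  show "vec.span (map_vec h ` B) \<subseteq> base_change h (vec.span B)"
    unfolding base_change_eq by (intro vec.span_mono image_mono vec.span_superset)
qed

text \<open>A linear map that separates b from the other basis vectors has a matrix, and the
  extended matrix still kills the images of the others but not that of b.\<close>

lemma independent_map_vec:
  fixes B :: "('a ^ 'n) set"
  assumes "vec.independent B"
  shows "vec.independent (map_vec h ` B)"
  unfolding vec.dependent_def
proof safe
  fix b assume b: "b \<in> B" "map_vec h b \<in> vec.span (map_vec h ` B - {map_vec h b})"
  \<comment> \<open>A coordinate functional, with values in \<open>'a ^ 'n\<close> so that its
    matrix is square; \<open>1\<close> is the vector with all coordinates 1.\<close>
  obtain g :: "'a ^ 'n \<Rightarrow> 'a ^ 'n" where g: "Vector_Spaces.linear (*s) (*s) g"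
    "\<forall>x\<in>B. g x = (if x = b then 1 else 0)"
    using vec.linear_independent_extend[OF assms, of "\<lambda>x. if x = b then 1 else 0"] by blast
  define A where "A = matrix g"
  have A: "A *v x = g x" for x using g(1) by (simp add: A_def matrix_works)
  have "vec.span (map_vec h ` B - {map_vec h b}) \<subseteq> {w. map_mat h A *v w = 0}"
  proof (rule vec.span_minimal)
    show "map_vec h ` B - {map_vec h b} \<subseteq> {w. map_mat h A *v w = 0}"
      using g(2) by (auto simp: map_mat_mult_vec A map_vec_0)
  qed (rule vec.subspace_kernel)
  then have "map_vec h (A *v b) = 0" using b(2) by (auto simp: map_mat_mult_vec)
  then show False using g(2) b(1) by (simp add: A map_vec_eq_0)
qed

lemma dim_base_change:
  assumes "vec.subspace L"
  shows "vec.dim (base_change h L) = vec.dim L"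
proof -
  obtain B where B: "B \<subseteq> L" "vec.independent B" "L \<subseteq> vec.span B" "card B = vec.dim L"
    using vec.basis_exists by blast
  have "vec.span B = L" using B assms by (simp add: subset_antisym vec.span_minimal)
  then have "base_change h L = vec.span (map_vec h ` B)" using base_change_span[of B] by simp
  then have "vec.dim (base_change h L) = card (map_vec h ` B)"
    using vec.dim_span_eq_card_independent[OF independent_map_vec[OF B(2)]] by simp
  also have "\<dots> = card B" by (intro card_image) (simp add: inj_on_def map_vec_inject)
  finally show ?thesis using B by simp
qed

lemma is_line_base_change: "is_line L \<Longrightarrow> is_line (base_change h L)"
  by (simp add: is_line_def subspace_base_change dim_base_change)

end

section \<open>Points as spans of vectors, and the action of matrices on them\<close>

lemma points_iff:
  assumes "vec.subspace L"
  shows "p \<in> points L \<longleftrightarrow> (\<exists>v\<in>L. v \<noteq> 0 \<and> p = vec.span {v})"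
proof
  assume p: "p \<in> points L"
  obtain B where B: "B \<subseteq> p" "vec.independent B" "p \<subseteq> vec.span B" "card B = vec.dim p"
    using vec.basis_exists by blast
  then obtain v where v: "B = {v}" using p by (auto simp: points_def card_1_singleton_iff)
  have "p = vec.span {v}"
    using B p v by (intro subset_antisym vec.span_minimal) (auto simp: points_def)
  moreover have "v \<noteq> 0" using B(2) v vec.dependent_zero by blast
  ultimately show "\<exists>v\<in>L. v \<noteq> 0 \<and> p = vec.span {v}" using B p v by (auto simp: points_def)
next
  assume "\<exists>v\<in>L. v \<noteq> 0 \<and> p = vec.span {v}"
  then obtain v where v: "v \<in> L" "v \<noteq> 0" "p = vec.span {v}" by blast
  moreover have "vec.dim (vec.span {v}) = 1"
    using vec.dim_span_eq_card_independent[of "{v}"] v by simp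
  ultimately show "p \<in> points L" using assms by (simp add: points_def vec.subspace_span vec.span_minimal)
qed

lemma span_singleton_eq:
  fixes u v :: "'a::field ^ 'n"
  assumes "u \<noteq> 0"
  shows "vec.span {u} = vec.span {v} \<longleftrightarrow> (\<exists>c. c \<noteq> 0 \<and> u = c *s v)"
proof
  assume "vec.span {u} = vec.span {v}"
  then have "u \<in> vec.span {v}" using vec.span_base[of u "{u}"] by simp
  then obtain c where "u = c *s v" by (auto simp: vec.span_singleton)
  then show "\<exists>c. c \<noteq> 0 \<and> u = c *s v" using assms by (intro exI[of _ c]) auto
next
  assume "\<exists>c. c \<noteq> 0 \<and> u = c *s v"
  then obtain c where c: "c \<noteq> 0" "u = c *s v" by blast
  then have "v = inverse c *s u" by simp
  then have "v \<in> vec.span {u}" by (metis insertI1 vec.span_base vec.span_scale)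
  moreover have "u \<in> vec.span {v}" using c by (metis insertI1 vec.span_base vec.span_scale)
  ultimately show "vec.span {u} = vec.span {v}" by (intro subset_antisym vec.span_minimal vec.subspace_span) auto
qed

lemma skew_iff:
  assumes "is_line L" "is_line M"
  shows "skew L M \<longleftrightarrow> L \<inter> M = {0}"
proof
  assume LM: "L \<inter> M = {0}"
  have False if p: "p \<in> points L" "p \<in> points M" for p
  proof -
    have "vec.subspace L" using assms by (simp add: is_line_def)
    then obtain v where v: "v \<in> L" "v \<noteq> 0" "p = vec.span {v}" using p(1) points_iff[of L p] by blast
    moreover have "v \<in> M" using v(3) p(2) vec.span_base[of v "{v}"] by (auto simp: points_def)
    ultimately show False using LM by blast
  qed
  then show "skew L M" by (auto simp: skew_def)
qed (use skew_imp_Int assms in blast)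

definition mat_act :: "'a::field ^ 4 ^ 4 \<Rightarrow> 'a subsp \<Rightarrow> 'a subsp \<Rightarrow> 'a subsp" where
  "mat_act A L = (\<lambda>p\<in>points L. (*v) A ` p)"

text \<open>Injectivity on L is expressed by a matrix C that undoes A there. This form is preserved
  by composition and by base change, where it has to be checked only on the image of L. The matrix A
  itself is usually singular, being a product of projections.\<close>

definition mat_emb :: "'a::field ^ 4 ^ 4 \<Rightarrow> 'a subsp \<Rightarrow> 'a subsp \<Rightarrow> bool" where
  "mat_emb A L M \<longleftrightarrow> (\<exists>C. \<forall>v\<in>L. A *v v \<in> M \<and> C *v (A *v v) = v)"

lemma mat_emb_eq_0: "mat_emb A L M \<Longrightarrow> v \<in> L \<Longrightarrow> A *v v = 0 \<Longrightarrow> v = 0"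
  unfolding mat_emb_def by (metis matrix_vector_mult_0_right)

lemma mat_act_span: "v \<in> L \<Longrightarrow> v \<noteq> 0 \<Longrightarrow> vec.subspace L \<Longrightarrow> mat_act A L (vec.span {v}) = vec.span {A *v v}"
  by (simp add: mat_act_def points_iff flip: vec.span_image) blast

lemma mat_act_in_points:
  assumes "mat_emb A L M" "vec.subspace L" "vec.subspace M" "p \<in> points L"
  shows "mat_act A L p \<in> points M"
proof -
  obtain v where v: "v \<in> L" "v \<noteq> 0" "p = vec.span {v}" using assms points_iff by blast
  moreover have "A *v v \<in> M" "A *v v \<noteq> 0"
    using assms v mat_emb_eq_0 unfolding mat_emb_def by blast+
  ultimately show ?thesis using assms by (auto simp: mat_act_span points_iff)
qed

lemma mat_emb_1: "mat_emb (mat 1) L L"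
  unfolding mat_emb_def by (intro exI[of _ "mat 1"]) simp

lemma mat_act_1: "mat_act (mat 1) L = (\<lambda>p\<in>points L. p)"
  by (simp add: mat_act_def)

lemma mat_emb_mult:
  assumes "mat_emb A L M" "mat_emb B M N"
  shows "mat_emb (B ** A) L N"
proof -
  obtain C D where "\<forall>v\<in>L. A *v v \<in> M \<and> C *v (A *v v) = v" "\<forall>v\<in>M. B *v v \<in> N \<and> D *v (B *v v) = v"
    using assms by (auto simp: mat_emb_def)
  then show ?thesis unfolding mat_emb_def
    by (intro exI[of _ "C ** D"]) (simp flip: matrix_vector_mul_assoc)
qed

lemma mat_act_mult:
  assumes "mat_emb A L M" "vec.subspace L" "vec.subspace M"
  shows "compose (points L) (mat_act B M) (mat_act A L) = mat_act (B ** A) L"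
proof
  fix p
  show "compose (points L) (mat_act B M) (mat_act A L) p = mat_act (B ** A) L p"
    using mat_act_in_points[OF assms, of p]
    by (auto simp: compose_def mat_act_def image_image matrix_vector_mul_assoc)
qed

lemma mat_act_scale:
  assumes "mat_emb B L M" "vec.subspace L" "\<And>v. v \<in> L \<Longrightarrow> B *v v = c *s (A *v v)"
  shows "mat_act A L = mat_act B L"
proof
  fix p
  show "mat_act A L p = mat_act B L p"
  proof (cases "p \<in> points L")
    case True
    then obtain v where v: "v \<in> L" "v \<noteq> 0" "p = vec.span {v}" using assms points_iff by blast
    have "B *v v \<noteq> 0" using mat_emb_eq_0 v assms by blast
    then have "c \<noteq> 0" using assms(3)[OF v(1)] by auto
    then have "vec.span {B *v v} = vec.span {A *v v}"
      using span_singleton_eq[OF \<open>B *v v \<noteq> 0\<close>] assms(3)[OF v(1)] by blast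
    then show ?thesis using v assms by (simp add: mat_act_span)
  qed (simp add: mat_act_def)
qed

text \<open>A linear map that multiplies every vector by some scalar is a scalar.\<close>

lemma mat_act_eq_imp_scale:
  assumes A: "mat_emb A L M" and B: "mat_emb B L M" and L: "vec.subspace L" and eq: "mat_act A L = mat_act B L"
  shows "\<exists>c. c \<noteq> 0 \<and> (\<forall>v\<in>L. B *v v = c *s (A *v v))"
proof (cases "L = {0}")
  case True
  then show ?thesis by (intro exI[of _ 1]) simp
next
  case False
  then obtain v0 where v0: "v0 \<in> L" "v0 \<noteq> 0" using vec.subspace_0[OF L] by blast
  obtain C where C: "\<And>v. v \<in> L \<Longrightarrow> C *v (A *v v) = v" using A by (auto simp: mat_emb_def)
  have ex: "\<exists>c. c \<noteq> 0 \<and> B *v v = c *s (A *v v)" if v: "v \<in> L" "v \<noteq> 0" for v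
  proof -
    have "vec.span {B *v v} = vec.span {A *v v}"
      using fun_cong[OF eq, of "vec.span {v}"] v L by (simp add: mat_act_span)
    moreover have "B *v v \<noteq> 0" using mat_emb_eq_0[OF B v(1)] v by blast
    ultimately show ?thesis using span_singleton_eq by blast
  qed
  obtain c0 where c0: "c0 \<noteq> 0" "B *v v0 = c0 *s (A *v v0)" using ex v0 by blast
  have "B *v v = c0 *s (A *v v)" if v: "v \<in> L" for v
  proof (cases "\<exists>k. v = k *s v0")
    case True
    then obtain k where "v = k *s v0" by blast
    then show ?thesis using c0 by (simp add: vec.scale mult.commute)
  next
    case False
    then have "v \<noteq> 0" by (metis vector_smult_lzero)
    then obtain c1 where c1: "B *v v = c1 *s (A *v v)" using ex v by blast
    have "v + v0 \<noteq> 0"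
    proof
      assume "v + v0 = 0"
      then have "v = (- 1) *s v0" by (simp add: eq_neg_iff_add_eq_0)
      with False show False by blast
    qed
    moreover have vv0: "v + v0 \<in> L" using v v0 L by (simp add: vec.subspace_add)
    ultimately obtain c where c: "B *v (v + v0) = c *s (A *v (v + v0))" using ex by blast
    \<comment> \<open>C brings the images under A back to v and v0, which are independent since v is
      no multiple of v0. Comparing coefficients then gives c = c1 and c = c0.\<close>
    have "C *v (B *v (v + v0)) = c *s v + c *s v0"
      unfolding c by (simp add: vec.scale C[OF vv0] vec.scale_right_distrib)
    moreover have "C *v (B *v (v + v0)) = c1 *s v + c0 *s v0"
      by (simp add: vec.add c1 c0 vec.scale C v v0)
    ultimately have *: "(c - c1) *s v = (c0 - c) *s v0"
      by (simp add: vec.scale_left_diff_distrib algebra_simps)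
    have "c = c1"
    proof (rule ccontr)
      assume "c \<noteq> c1"
      then have "v = inverse (c - c1) *s ((c - c1) *s v)" by simp
      then have "v = (inverse (c - c1) * (c0 - c)) *s v0" by (simp only: * vec.scale_scale)
      with False show False by blast
    qed
    then have "c0 = c" using * v0 by simp
    then show ?thesis using c1 \<open>c = c1\<close> by simp
  qed
  then show ?thesis using c0 by blast
qed

section \<open>Line maps as linear projections\<close>

text \<open>Bases of M and of N are together independent, by counting dimensions in M + N. A linear
  map can therefore fix the first and kill the second.\<close>

lemma complementary_projection:
  fixes M N :: "('a::field ^ 'n) set"
  assumes M: "vec.subspace M" and N: "vec.subspace N" and MN: "M \<inter> N = {0}"
  shows "\<exists>P. (\<forall>v\<in>M. P *v v = v) \<and> (\<forall>v\<in>N. P *v v = 0)"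
proof -
  obtain B where B: "B \<subseteq> M" "vec.independent B" "M \<subseteq> vec.span B" "card B = vec.dim M"
    using vec.basis_exists by blast
  obtain D where D: "D \<subseteq> N" "vec.independent D" "N \<subseteq> vec.span D" "card D = vec.dim N"
    using vec.basis_exists by blast
  have fin: "finite B" "finite D" using B D vec.finiteI_independent by blast+
  have sp: "vec.span B = M" "vec.span D = N" using B D M N by (simp_all add: subset_antisym vec.span_minimal)
  have "vec.dim {x + y |x y. x \<in> M \<and> y \<in> N} + vec.dim (M \<inter> N) = vec.dim M + vec.dim N"
    using M N by (rule vec.dim_sums_Int)
  then have "vec.dim (vec.span (B \<union> D)) = vec.dim M + vec.dim N"
    unfolding vec.span_Un sp MN by simp
  then have "card (B \<union> D) \<le> vec.dim (vec.span (B \<union> D))" using card_Un_le[of B D] B D by simp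
  then have "vec.independent (B \<union> D)"
    using fin by (intro vec.card_le_dim_spanning[OF vec.span_superset]) auto
  then obtain g :: "'a ^ 'n \<Rightarrow> 'a ^ 'n" where g: "Vector_Spaces.linear (*s) (*s) g"
    "\<forall>x\<in>B \<union> D. g x = (if x \<in> B then x else 0)"
    using vec.linear_independent_extend[of "B \<union> D" "\<lambda>x. if x \<in> B then x else 0"] by blast
  define P where "P = matrix g"
  have P: "P *v x = g x" for x using g(1) by (simp add: P_def matrix_works)
  have "vec.span B \<subseteq> {v. P *v v = v}"
  proof (rule vec.span_minimal)
    show "B \<subseteq> {v. P *v v = v}" using g by (auto simp: P)
    show "vec.subspace {v. P *v v = v}" by (auto simp: vec.subspace_def vec.add vec.scale)
  qed
  moreover have "x \<notin> B" if "x \<in> D" for x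
  proof
    assume "x \<in> B"
    then have "x = 0" using that B(1) D(1) MN by auto
    then show False using that D(2) vec.dependent_zero[of D] by simp
  qed
  then have "vec.span D \<subseteq> {v. P *v v = 0}"
    by (intro vec.span_minimal vec.subspace_kernel) (use g in \<open>auto simp: P\<close>)
  ultimately show ?thesis unfolding sp by blast
qed

text \<open>Since 2 + 2 = 4, two skew lines span the whole coordinate space.\<close>

lemma skew_lines_decompose:
  assumes "is_line M" "is_line N" "skew M N"
  shows "\<exists>m\<in>M. \<exists>n\<in>N. v = m + n"
proof -
  have s: "vec.subspace M" "vec.subspace N" "vec.dim M = 2" "vec.dim N = 2" using assms by (auto simp: is_line_def)
  have "vec.dim (vec.span (M \<union> N)) = 4" using dim_join[OF s(1,2) skew_imp_Int[OF assms]] s by simp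
  then have "vec.span (M \<union> N) = UNIV"
    by (intro vec.subspace_dim_equal) (simp_all add: vec.subspace_span card_cart_basis)
  moreover have "vec.span M = M" "vec.span N = N" using s by (simp_all only: vec.span_eq_iff)
  ultimately have "v \<in> {x + y |x y. x \<in> M \<and> y \<in> N}" by (simp add: vec.span_Un)
  then show ?thesis by blast
qed

text \<open>For skew lines this determines P, because the space is the direct sum of M and N. No
  idempotence or image is prescribed: the conditions are linear equations on M and N and hence pass
  to larger fields.\<close>

definition projection_along :: "'a::field subsp \<Rightarrow> 'a subsp \<Rightarrow> 'a ^ 4 ^ 4 \<Rightarrow> bool" where
  "projection_along M N P \<longleftrightarrow> (\<forall>v\<in>M. P *v v = v) \<and> (\<forall>v\<in>N. P *v v = 0)"

lemma projection_along_ex: "is_line M \<Longrightarrow> is_line N \<Longrightarrow> skew M N \<Longrightarrow> \<exists>P. projection_along M N P"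
  unfolding projection_along_def
  using complementary_projection[of M N] skew_imp_Int[of M N] by (simp add: is_line_def)

lemma projection_along_in:
  assumes "is_line M" "is_line N" "skew M N" "projection_along M N P"
  shows "P *v v \<in> M" "v - P *v v \<in> N"
  using skew_lines_decompose[OF assms(1-3), of v] assms(4)
  by (auto simp: projection_along_def vec.add)

text \<open>The inverse of the projection from L to M along N is the projection Q onto L along N:
  the difference v - P v lies in N and is killed by Q.\<close>

lemma mat_emb_projection:
  assumes "is_line L" "is_line M" "is_line N" "skew L N" "skew M N" "projection_along M N P"
  shows "mat_emb P L M"
proof -
  obtain Q where Q: "projection_along L N Q" using projection_along_ex assms by blast
  have "Q *v (P *v v) = v" if "v \<in> L" for v
  proof -
    have "Q *v (v - P *v v) = 0" using Q projection_along_in(2)[OF assms(2,3,5,6)] by (simp add: projection_along_def)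
    then show ?thesis using Q that by (simp add: projection_along_def vec.diff)
  qed
  then show ?thesis using projection_along_in(1)[OF assms(2,3,5,6)] by (auto simp: mat_emb_def)
qed

text \<open>For v in p the vector v - P v lies in N, so P v is in the plane spanned by p and N, and
  it lies on M. Conversely, a vector x + y of M with x in p and y in N is fixed by P and therefore
  equals P x.\<close>

lemma line_map_eq_projection:
  assumes L: "is_line L" and M: "is_line M" and N: "is_line N" and MN: "skew M N" and P: "projection_along M N P"
  shows "line_map L M N = mat_act P L"
proof -
  have "vec.span (p \<union> N) \<inter> M = (*v) P ` p" if p: "p \<in> points L" for p
  proof
    have sp: "vec.span p = p" "vec.span N = N"
      using p N by (simp_all only: vec.span_eq_iff points_def is_line_def mem_Collect_eq)
    have "vec.span (p \<union> N) = {x + y |x y. x \<in> p \<and> y \<in> N}" unfolding vec.span_Un sp ..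
    then show "vec.span (p \<union> N) \<inter> M \<subseteq> (*v) P ` p"
      using P unfolding projection_along_def by (force simp: vec.add)
    show "(*v) P ` p \<subseteq> vec.span (p \<union> N) \<inter> M"
    proof (intro subsetI IntI)
      fix w assume "w \<in> (*v) P ` p"
      then obtain v where v: "v \<in> p" "w = P *v v" by blast
      show "w \<in> M" using projection_along_in(1)[OF M N MN P] v by simp
      have "v - (v - P *v v) \<in> vec.span (p \<union> N)"
        using projection_along_in(2)[OF M N MN P] v by (intro vec.span_diff vec.span_base) auto
      then show "w \<in> vec.span (p \<union> N)" using v by simp
    qed
  qed
  then show ?thesis by (auto simp: line_map_def mat_act_def fun_eq_iff)
qed

section \<open>Base change of lines, matrices and arrows\<close>

context field_ext
begin

lemma projection_along_base_change:
  assumes "projection_along M N P"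
  shows "projection_along (base_change h M) (base_change h N) (map_mat h P)"
proof -
  have "base_change h M \<subseteq> {v. map_mat h P *v v = v}"
    using assms by (intro base_change_least)
      (auto simp: projection_along_def map_mat_mult_vec vec.subspace_def vec.add vec.scale)
  moreover have "base_change h N \<subseteq> {v. map_mat h P *v v = 0}"
    using assms by (intro base_change_least vec.subspace_kernel)
      (auto simp: projection_along_def map_mat_mult_vec map_vec_0)
  ultimately show ?thesis by (auto simp: projection_along_def)
qed

text \<open>A matrix that fixes M and kills N witnesses that they meet in 0 only, and this witness
  can be extended to the larger field.\<close>

lemma skew_base_change:
  assumes "is_line M" "is_line N" "skew M N"
  shows "skew (base_change h M) (base_change h N)"
proof -
  obtain P where "projection_along M N P" using projection_along_ex assms by blast
  then have "projection_along (base_change h M) (base_change h N) (map_mat h P)"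
    by (rule projection_along_base_change)
  then have "base_change h M \<inter> base_change h N \<subseteq> {0}" by (force simp: projection_along_def)
  then show ?thesis
    using vec.subspace_0[OF subspace_base_change] skew_iff is_line_base_change assms by blast
qed

lemma mat_emb_base_change:
  assumes "mat_emb A L M"
  shows "mat_emb (map_mat h A) (base_change h L) (base_change h M)"
proof -
  obtain C where C: "\<forall>v\<in>L. A *v v \<in> M \<and> C *v (A *v v) = v" using assms by (auto simp: mat_emb_def)
  have "base_change h L \<subseteq> {w. map_mat h A *v w \<in> base_change h M}"
    using C subspace_base_change[of M]
    by (intro base_change_least) (auto simp: map_mat_mult_vec map_vec_in_base_change vec.subspace_def vec.add vec.scale)
  moreover have "base_change h L \<subseteq> {w. map_mat h C *v (map_mat h A *v w) = w}"
    using C by (intro base_change_least) (auto simp: map_mat_mult_vec vec.subspace_def vec.add vec.scale)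
  ultimately show ?thesis unfolding mat_emb_def by blast
qed

text \<open>Both sides say that A and B are proportional on the line. The factor c becomes
  \<open>h c\<close> over the large field; in the other direction, the factor relates vectors with
  coordinates in the small field and so comes from there.\<close>

lemma mat_act_base_change_eq_iff:
  assumes A: "mat_emb A L M" and B: "mat_emb B L M" and L: "vec.subspace L"
  shows "mat_act (map_mat h A) (base_change h L) = mat_act (map_mat h B) (base_change h L) \<longleftrightarrow>
    mat_act A L = mat_act B L"
proof
  assume "mat_act A L = mat_act B L"
  then obtain c where c: "\<forall>v\<in>L. B *v v = c *s (A *v v)" using mat_act_eq_imp_scale[OF A B L] by blast
  have "base_change h L \<subseteq> {w. map_mat h B *v w = h c *s (map_mat h A *v w)}"
    using c by (intro base_change_least)
      (auto simp: map_mat_mult_vec map_vec_scale vec.subspace_def vec.add vec.scale vec.scale_right_distrib mult.commute)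
  then show "mat_act (map_mat h A) (base_change h L) = mat_act (map_mat h B) (base_change h L)"
    using mat_act_scale[OF mat_emb_base_change[OF B] subspace_base_change] by blast
next
  assume eq: "mat_act (map_mat h A) (base_change h L) = mat_act (map_mat h B) (base_change h L)"
  obtain c where c: "\<forall>w\<in>base_change h L. map_mat h B *v w = c *s (map_mat h A *v w)"
    using mat_act_eq_imp_scale[OF mat_emb_base_change[OF A] mat_emb_base_change[OF B] subspace_base_change eq] by blast
  show "mat_act A L = mat_act B L"
  proof
    fix p
    show "mat_act A L p = mat_act B L p"
    proof (cases "p \<in> points L")
      case True
      then obtain v where v: "v \<in> L" "v \<noteq> 0" "p = vec.span {v}" using L points_iff by blast
      have nz: "A *v v \<noteq> 0" "B *v v \<noteq> 0" using mat_emb_eq_0 A B v by blast+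
      have "map_vec h (B *v v) = c *s map_vec h (A *v v)"
        using c map_vec_in_base_change[OF v(1)] by (simp flip: map_mat_mult_vec)
      then obtain d where "B *v v = d *s (A *v v)" using map_vec_proportional nz by blast
      moreover from this have "d \<noteq> 0" using nz by auto
      ultimately show ?thesis using span_singleton_eq[OF nz(2)] v L by (auto simp: mat_act_span)
    qed (simp add: mat_act_def)
  qed
qed

lemma base_change_inj_on:
  assumes "skew_lines \<L>"
  shows "inj_on (base_change h) \<L>"
proof
  fix L M assume LM: "L \<in> \<L>" "M \<in> \<L>" "base_change h L = base_change h M"
  show "L = M"
  proof (rule ccontr)
    assume "L \<noteq> M"
    then have l: "is_line L" "is_line M" "skew L M" using assms LM by (auto simp: skew_lines_def)
    then have "base_change h L \<inter> base_change h M = {0}"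
      using skew_imp_Int skew_base_change is_line_base_change by blast
    then have "base_change h L \<subseteq> {0}" using LM by simp
    then have "vec.dim (base_change h L) = 0" by simp
    then show False using is_line_base_change[OF l(1)] unfolding is_line_def by linarith
  qed
qed

lemma skew_lines_base_change:
  assumes "skew_lines \<L>"
  shows "skew_lines (base_change h ` \<L>)"
proof -
  have "skew (base_change h L) (base_change h M)"
    if "L \<in> \<L>" "M \<in> \<L>" "base_change h L \<noteq> base_change h M" for L M
    using that assms by (intro skew_base_change) (auto simp: skew_lines_def)
  then show ?thesis using assms is_line_base_change by (simp add: skew_lines_def)
qed

text \<open>One projection matrix computes the line map over both fields. This is the reason why the
  canonical isomorphism takes generators to generators.\<close>

lemma line_map_base_change:
  assumes "skew_lines \<L>" "L \<in> \<L>" "M \<in> \<L>" "N \<in> \<L>" "distinct [L, M, N]"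
  shows "\<exists>P. mat_emb P L M \<and> line_map L M N = mat_act P L \<and>
    line_map (base_change h L) (base_change h M) (base_change h N) = mat_act (map_mat h P) (base_change h L)"
proof -
  have l: "is_line L" "is_line M" "is_line N" "skew L N" "skew M N" using assms by (auto simp: skew_lines_def)
  obtain P where P: "projection_along M N P" using projection_along_ex l by blast
  then show ?thesis
    using mat_emb_projection[OF l P] line_map_eq_projection[OF l(1-3,5) P]
      line_map_eq_projection[OF is_line_base_change[OF l(1)] is_line_base_change[OF l(2)]
        is_line_base_change[OF l(3)] skew_base_change[OF l(2,3,5)] projection_along_base_change[OF P]]
    by blast
qed

lemma arrow_base_change:
  assumes "skew_lines \<L>" "is_arrow \<L> L M f"
  shows "\<exists>A. mat_emb A L M \<and> f = mat_act A L \<and>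
    is_arrow (base_change h ` \<L>) (base_change h L) (base_change h M) (mat_act (map_mat h A) (base_change h L))"
  using assms(2)
proof induction
  case (identity L)
  have "mat_act (map_mat h (mat 1)) (base_change h L) = (\<lambda>p\<in>points (base_change h L). p)"
    unfolding map_mat_1 by (rule mat_act_1)
  with is_arrow.identity[of "base_change h L" "base_change h ` \<L>"] identity
  show ?case using mat_emb_1[of L] mat_act_1[of L] by (metis imageI)
next
  case (generator L M N)
  then obtain P where P: "mat_emb P L M" "line_map L M N = mat_act P L"
    "line_map (base_change h L) (base_change h M) (base_change h N) = mat_act (map_mat h P) (base_change h L)"
    using line_map_base_change assms by blast
  have "distinct [base_change h L, base_change h M, base_change h N]"
    using generator inj_on_eq_iff[OF base_change_inj_on[OF assms(1)]] by auto
  then show ?case using P generator is_arrow.generator[of "base_change h L" "base_change h ` \<L>"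
      "base_change h M" "base_change h N"] by (intro exI[of _ P]) auto
next
  case (composite L M f N g)
  then obtain A B where A: "mat_emb A L M" "f = mat_act A L"
      "is_arrow (base_change h ` \<L>) (base_change h L) (base_change h M) (mat_act (map_mat h A) (base_change h L))"
    and B: "mat_emb B M N" "g = mat_act B M"
      "is_arrow (base_change h ` \<L>) (base_change h M) (base_change h N) (mat_act (map_mat h B) (base_change h M))"
    by blast
  have s: "vec.subspace L" "vec.subspace M"
    using is_arrow_props[OF assms(1) composite(1)] assms(1) by (auto simp: skew_lines_def is_line_def)
  show ?case
    using mat_emb_mult[OF A(1) B(1)] mat_act_mult[OF A(1) s, of B] A B is_arrow.composite[OF A(3) B(3)]
      mat_act_mult[OF mat_emb_base_change[OF A(1)] subspace_base_change subspace_base_change, of "map_mat h B"]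
    by (intro exI[of _ "B ** A"]) (simp add: map_mat_mult)
qed

text \<open>Surjectivity in (e): enlarging the field creates no arrows between the extended lines,
  since their generators are given by matrices over the small field and so are all
  composites.\<close>

lemma base_change_arrow_descends:
  assumes sk: "skew_lines \<L>" and "is_arrow (base_change h ` \<L>) U V g"
  shows "\<exists>L\<in>\<L>. \<exists>M\<in>\<L>. \<exists>A. U = base_change h L \<and> V = base_change h M \<and> mat_emb A L M \<and>
    is_arrow \<L> L M (mat_act A L) \<and> g = mat_act (map_mat h A) (base_change h L)"
  using assms(2)
proof induction
  case (identity U)
  then obtain L where L: "L \<in> \<L>" "U = base_change h L" by blast
  have "is_arrow \<L> L L (mat_act (mat 1) L)" unfolding mat_act_1 using L by (intro is_arrow.identity)
  moreover have "(\<lambda>p\<in>points U. p) = mat_act (map_mat h (mat 1)) (base_change h L)"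
    unfolding map_mat_1 mat_act_1 L ..
  ultimately show ?case using L mat_emb_1 by blast
next
  case (generator U V W)
  then obtain L M N where L: "L \<in> \<L>" "M \<in> \<L>" "N \<in> \<L>"
    "U = base_change h L" "V = base_change h M" "W = base_change h N" by blast
  then have d: "distinct [L, M, N]" using generator by auto
  then obtain P where "mat_emb P L M" "line_map L M N = mat_act P L"
    "line_map (base_change h L) (base_change h M) (base_change h N) = mat_act (map_mat h P) (base_change h L)"
    using line_map_base_change[OF sk L(1-3)] by blast
  then show ?case using is_arrow.generator[OF L(1-3) d] L by metis
next
  case (composite U V f W g)
  then obtain L M A where A: "L \<in> \<L>" "M \<in> \<L>" "U = base_change h L" "V = base_change h M" "mat_emb A L M"
    "is_arrow \<L> L M (mat_act A L)" "f = mat_act (map_mat h A) (base_change h L)" by blast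
  from composite obtain M' N B where B: "M' \<in> \<L>" "N \<in> \<L>" "V = base_change h M'" "W = base_change h N"
    "mat_emb B M' N" "is_arrow \<L> M' N (mat_act B M')" "g = mat_act (map_mat h B) (base_change h M')" by blast
  \<comment> \<open>The two induction hypotheses choose the middle line separately; distinct lines
    have distinct base changes, so the choices agree.\<close>
  have M': "M' = M" using A B base_change_inj_on[OF sk] by (auto dest: inj_onD)
  have s: "vec.subspace L" "vec.subspace M" using A sk by (auto simp: skew_lines_def is_line_def)
  have "is_arrow \<L> L N (mat_act (B ** A) L)"
    using is_arrow.composite[OF A(6) B(6)[unfolded M']] mat_act_mult[OF A(5) s] by simp
  moreover have "compose (points U) g f = mat_act (map_mat h (B ** A)) (base_change h L)"
    unfolding A B M' map_mat_mult
    using mat_act_mult[OF mat_emb_base_change[OF A(5)] subspace_base_change subspace_base_change] by blast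
  moreover have "mat_emb (B ** A) L N" using mat_emb_mult A(5) B(5) M' by blast
  ultimately show ?case using A(1,3) B(2,4) by blast
qed

text \<open>The result is independent of the chosen matrix by
  \<open>mat_act_base_change_eq_iff\<close>. A matrix is needed because f, a function on the points
  over the small field, has no evident value at the new points.\<close>

definition arrow_ext :: "'a subsp \<Rightarrow> 'a subsp \<Rightarrow> ('a subsp \<Rightarrow> 'a subsp) \<Rightarrow> 'b subsp \<Rightarrow> 'b subsp" where
  "arrow_ext L M f = mat_act (map_mat h (SOME A. mat_emb A L M \<and> f = mat_act A L)) (base_change h L)"

lemma arrow_ext_mat_act:
  assumes "mat_emb A L M" "vec.subspace L"
  shows "arrow_ext L M (mat_act A L) = mat_act (map_mat h A) (base_change h L)"
proof -
  let ?B = "SOME B. mat_emb B L M \<and> mat_act A L = mat_act B L"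
  have "mat_emb ?B L M \<and> mat_act A L = mat_act ?B L" by (rule someI[of _ A]) (use assms in simp)
  then show ?thesis using mat_act_base_change_eq_iff[OF _ assms(1,2), of ?B] by (simp add: arrow_ext_def)
qed

lemma canonical_iso_arrow_ext:
  assumes sk: "skew_lines \<L>"
  shows "canonical_iso h \<L> arrow_ext"
proof -
  have sub: "vec.subspace L" if "L \<in> \<L>" for L using that sk by (auto simp: skew_lines_def is_line_def)
  have rep: "\<exists>A. mat_emb A L M \<and> f = mat_act A L \<and> is_arrow (base_change h ` \<L>) (base_change h L) (base_change h M) (arrow_ext L M f)"
    if "L \<in> \<L>" "is_arrow \<L> L M f" for L M f
    using arrow_base_change[OF sk that(2)] arrow_ext_mat_act sub[OF that(1)] by metis
  have "bij_betw (arrow_ext L M) {f. is_arrow \<L> L M f}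
      {f. is_arrow (base_change h ` \<L>) (base_change h L) (base_change h M) f}"
    if LM: "L \<in> \<L>" "M \<in> \<L>" for L M
  proof (intro bij_betw_imageI inj_onI)
    fix f g assume fg: "f \<in> {f. is_arrow \<L> L M f}" "g \<in> {f. is_arrow \<L> L M f}" "arrow_ext L M f = arrow_ext L M g"
    obtain A B where "mat_emb A L M" "f = mat_act A L" "mat_emb B L M" "g = mat_act B L"
      using rep LM fg by (metis mem_Collect_eq)
    then show "f = g" using fg(3) mat_act_base_change_eq_iff sub[OF LM(1)] by (auto simp: arrow_ext_mat_act)
  next
    show "arrow_ext L M ` {f. is_arrow \<L> L M f} = {f. is_arrow (base_change h ` \<L>) (base_change h L) (base_change h M) f}"
    proof (intro subset_antisym subsetI)
      fix g assume "g \<in> {f. is_arrow (base_change h ` \<L>) (base_change h L) (base_change h M) f}"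
      then obtain L' M' A where A: "L' \<in> \<L>" "M' \<in> \<L>" "base_change h L = base_change h L'"
        "base_change h M = base_change h M'" "mat_emb A L' M'" "is_arrow \<L> L' M' (mat_act A L')"
        "g = mat_act (map_mat h A) (base_change h L')"
        using base_change_arrow_descends[OF sk] by blast
      then have [simp]: "L' = L" "M' = M" using LM base_change_inj_on[OF sk] by (auto dest: inj_onD)
      show "g \<in> arrow_ext L M ` {f. is_arrow \<L> L M f}"
        using A arrow_ext_mat_act[of A L M] sub[OF LM(1)] by (intro image_eqI[of _ _ "mat_act A L"]) auto
    qed (use rep LM in auto)
  qed
  moreover have "arrow_ext L L (\<lambda>p\<in>points L. p) = (\<lambda>p\<in>points (base_change h L). p)" if "L \<in> \<L>" for L
    using arrow_ext_mat_act[OF mat_emb_1 sub[OF that]] by (simp add: map_mat_1 mat_act_1)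
  moreover have "arrow_ext L N (compose (points L) g f) =
      compose (points (base_change h L)) (arrow_ext M N g) (arrow_ext L M f)"
    if LMN: "L \<in> \<L>" "M \<in> \<L>" "N \<in> \<L>" "is_arrow \<L> L M f" "is_arrow \<L> M N g" for L M N f g
  proof -
    obtain A B where A: "mat_emb A L M" "f = mat_act A L" and B: "mat_emb B M N" "g = mat_act B M"
      using rep LMN by metis
    show ?thesis unfolding A(2) B(2)
      using A B LMN sub mat_act_mult[OF A(1), of B] arrow_ext_mat_act[OF mat_emb_mult[OF A(1) B(1)]]
        mat_act_mult[OF mat_emb_base_change[OF A(1)] subspace_base_change subspace_base_change, of "map_mat h B"]
      by (simp add: arrow_ext_mat_act map_mat_mult)
  qed
  moreover have "arrow_ext L M (line_map L M N) = line_map (base_change h L) (base_change h M) (base_change h N)"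
    if "L \<in> \<L>" "M \<in> \<L>" "N \<in> \<L>" "distinct [L, M, N]" for L M N
    using line_map_base_change[OF sk that] arrow_ext_mat_act sub[OF that(1)] by metis
  moreover have "groupoid (line_groupoid \<L>)" "groupoid (line_groupoid (base_change h ` \<L>))"
    using groupoid_line_groupoid sk skew_lines_base_change by blast+
  ultimately show ?thesis
    unfolding canonical_iso_def groupoid_iso_def using base_change_inj_on[OF sk]
    by (auto simp: line_groupoid_def inj_on_imp_bij_betw)
qed

text \<open>Generators, identities and composites are all prescribed. The membership of L and M is
  carried along because the composition law is available only for lines of the configuration, and
  the middle line of a composite is known to be one only by induction.\<close>

lemma canonical_iso_unique:
  assumes can: "canonical_iso h \<L> \<Phi>" "canonical_iso h \<L> \<Psi>" and f: "is_arrow \<L> L M f"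
  shows "\<Psi> L M f = \<Phi> L M f \<and> L \<in> \<L> \<and> M \<in> \<L>"
  using f
proof induction
  case (identity L)
  have "\<Theta> L L (\<lambda>p\<in>points L. p) = (\<lambda>p\<in>points (base_change h L). p)"
    if "canonical_iso h \<L> \<Theta>" for \<Theta>
    using that identity unfolding canonical_iso_def groupoid_iso_def line_groupoid_def by simp
  from this[OF can(1)] this[OF can(2)] identity show ?case by metis
next
  case (generator L M N)
  then show ?case using can by (simp add: canonical_iso_def)
next
  case (composite L M f N g)
  then show ?case using can by (auto simp: canonical_iso_def groupoid_iso_def line_groupoid_def)
qed

lemma canonical_iso_vertex_iso:
  assumes "canonical_iso h \<L> \<Phi>" "L \<in> \<L>"
  shows "\<Phi> L L \<in> iso (line_group \<L> L) (line_group (base_change h ` \<L>) (base_change h L))"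
  using assms unfolding iso_def hom_def canonical_iso_def groupoid_iso_def
  by (auto simp: line_group_def vertex_group_def line_groupoid_def bij_betw_def)

end

section \<open>Generators and vertex groups\<close>

context
  fixes \<L> :: "'a::field subsp set" and L M f
  assumes sk: "skew_lines \<L>" and f: "is_arrow \<L> L M f"
begin

lemma arrow_dom: "L \<in> \<L> \<and> M \<in> \<L>"
  using is_arrow_props[OF sk f] by simp

lemma arrow_extensional: "f \<in> extensional (points L)"
  using is_arrow_props[OF sk f] by simp

lemma arrow_point: "p \<in> points L \<Longrightarrow> f p \<in> points M"
  using is_arrow_props[OF sk f] by simp

lemma arrow_inverse:
  obtains g where "is_arrow \<L> M L g" "\<And>p. p \<in> points L \<Longrightarrow> g (f p) = p" "\<And>q. q \<in> points M \<Longrightarrow> f (g q) = q"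
  using is_arrow_props[OF sk f] by metis

end

lemma carrier_line_group: "carrier (line_group \<L> L) = {f. is_arrow \<L> L L f}"
  and mult_line_group: "x \<otimes>\<^bsub>line_group \<L> L\<^esub> y = compose (points L) x y"
  and one_line_group: "\<one>\<^bsub>line_group \<L> L\<^esub> = (\<lambda>p\<in>points L. p)"
  by (simp_all add: line_group_def vertex_group_def line_groupoid_def)

lemma third_line_ex:
  assumes "card \<L> \<ge> 3"
  shows "\<exists>N\<in>\<L>. N \<noteq> L \<and> N \<noteq> M"
proof (rule ccontr)
  assume "\<not> ?thesis"
  then have "\<L> \<subseteq> {L, M}" by auto
  then have "card \<L> \<le> card {L, M}" by (intro card_mono) auto
  also have "\<dots> \<le> 2" by (simp add: card_insert_if)
  finally show False using assms by simp
qed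

lemma connecting_arrow_ex:
  assumes "card \<L> \<ge> 3" "L \<in> \<L>" "M \<in> \<L>"
  shows "\<exists>s. is_arrow \<L> L M s"
proof (cases "L = M")
  case True
  then show ?thesis using is_arrow.identity[OF assms(2)] by blast
next
  case False
  obtain N where "N \<in> \<L>" "N \<noteq> L" "N \<noteq> M" using third_line_ex[OF assms(1)] by blast
  then have "is_arrow \<L> L M (line_map L M N)" using assms False by (intro is_arrow.generator) auto
  then show ?thesis by (intro exI[of _ "line_map L M N"])
qed

section \<open>Generation of the vertex groups by basic loops\<close>

lemma two_step_loopsI:
  "\<lbrakk>M \<in> \<L>; N \<in> \<L>; P \<in> \<L>; distinct [L, M, N]; distinct [M, L, P]\<rbrakk>
    \<Longrightarrow> compose (points L) (line_map M L P) (line_map L M N) \<in> two_step_loops \<L> L"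
  unfolding two_step_loops_def by blast

lemma three_step_loopsI:
  "\<lbrakk>M \<in> \<L>; N \<in> \<L>; P \<in> \<L>; distinct [L, M, N]; distinct [M, N, P]; distinct [N, L, M]\<rbrakk>
    \<Longrightarrow> compose (points L) (line_map N L M) (compose (points L) (line_map M N P) (line_map L M N))
      \<in> three_step_loops \<L> L"
  unfolding three_step_loops_def by blast

lemma basic_loops_subset_carrier: "basic_loops \<L> L \<subseteq> carrier (line_group \<L> L)" if "L \<in> \<L>"
proof
  fix x assume "x \<in> basic_loops \<L> L"
  then consider "x \<in> two_step_loops \<L> L" | "x \<in> three_step_loops \<L> L" by (auto simp: basic_loops_def)
  then show "x \<in> carrier (line_group \<L> L)"
  proof cases
    case 1
    then obtain M N P where *: "M \<in> \<L>" "N \<in> \<L>" "P \<in> \<L>" "distinct [L, M, N]" "distinct [M, L, P]"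
      "x = compose (points L) (line_map M L P) (line_map L M N)"
      unfolding two_step_loops_def by blast
    then show ?thesis unfolding carrier_line_group mem_Collect_eq *(6) using that
      by (intro is_arrow.composite[of _ L M _ L] is_arrow.generator)
  next
    case 2
    then obtain M N P where *: "M \<in> \<L>" "N \<in> \<L>" "P \<in> \<L>" "distinct [L, M, N]" "distinct [M, N, P]" "distinct [N, L, M]"
      "x = compose (points L) (line_map N L M) (compose (points L) (line_map M N P) (line_map L M N))"
      unfolding three_step_loops_def by blast
    then show ?thesis unfolding carrier_line_group mem_Collect_eq *(7) using that
      by (intro is_arrow.composite[of _ L N _ L] is_arrow.composite[of _ L M _ N] is_arrow.generator)
  qed
qed

lemma finite_basic_loops:
  assumes "finite \<L>"
  shows "finite (basic_loops \<L> L)"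
proof -
  have "two_step_loops \<L> L \<subseteq> (\<lambda>(M, N, P). compose (points L) (line_map M L P) (line_map L M N)) ` (\<L> \<times> \<L> \<times> \<L>)"
  proof
    fix x assume "x \<in> two_step_loops \<L> L"
    then obtain M N P where "M \<in> \<L>" "N \<in> \<L>" "P \<in> \<L>"
      "x = compose (points L) (line_map M L P) (line_map L M N)" unfolding two_step_loops_def by blast
    then show "x \<in> (\<lambda>(M, N, P). compose (points L) (line_map M L P) (line_map L M N)) ` (\<L> \<times> \<L> \<times> \<L>)"
      by (intro image_eqI[of _ _ "(M, N, P)"]) auto
  qed
  moreover have "three_step_loops \<L> L \<subseteq> (\<lambda>(M, N, P). compose (points L) (line_map N L M)
      (compose (points L) (line_map M N P) (line_map L M N))) ` (\<L> \<times> \<L> \<times> \<L>)"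
  proof
    fix x assume "x \<in> three_step_loops \<L> L"
    then obtain M N P where "M \<in> \<L>" "N \<in> \<L>" "P \<in> \<L>"
      "x = compose (points L) (line_map N L M) (compose (points L) (line_map M N P) (line_map L M N))"
      unfolding three_step_loops_def by blast
    then show "x \<in> (\<lambda>(M, N, P). compose (points L) (line_map N L M)
        (compose (points L) (line_map M N P) (line_map L M N))) ` (\<L> \<times> \<L> \<times> \<L>)"
      by (intro image_eqI[of _ _ "(M, N, P)"]) auto
  qed
  ultimately have "finite (two_step_loops \<L> L)" "finite (three_step_loops \<L> L)"
    using assms by (simp_all add: finite_subset)
  then show ?thesis by (simp add: basic_loops_def)
qed

definition tree_arrows :: "'a::field subsp set \<Rightarrow> 'a subsp \<Rightarrow> 'a subsp \<Rightarrow> ('a subsp \<Rightarrow> 'a subsp) set" where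
  "tree_arrows \<L> A B = (if A = B then {\<lambda>p\<in>points A. p}
     else {line_map A B N | N. N \<in> \<L> \<and> distinct [A, B, N]})"

lemma tree_arrows_refl: "tree_arrows \<L> A A = {\<lambda>p\<in>points A. p}"
  by (simp add: tree_arrows_def)

lemma tree_arrowsE:
  assumes "t \<in> tree_arrows \<L> A B" "A \<noteq> B"
  obtains N where "t = line_map A B N" "N \<in> \<L>" "distinct [A, B, N]"
  using assms unfolding tree_arrows_def by auto

lemma tree_arrows_is_arrow: "A \<in> \<L> \<Longrightarrow> B \<in> \<L> \<Longrightarrow> t \<in> tree_arrows \<L> A B \<Longrightarrow> is_arrow \<L> A B t"
  by (auto simp: tree_arrows_def intro: is_arrow.identity is_arrow.generator split: if_splits)

text \<open>The third index of the closing edges does not matter because of the two-step loops.\<close>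

lemma closed_up_arrow_in_generate:
  assumes sk: "skew_lines \<L>" and c: "card \<L> \<ge> 3" and L: "L \<in> \<L>" and f: "is_arrow \<L> A B f"
    and t: "t \<in> tree_arrows \<L> L A" and u: "u \<in> tree_arrows \<L> B L"
  shows "compose (points L) u (compose (points L) f t) \<in> generate (line_group \<L> L) (basic_loops \<L> L)"
  using f t u
proof (induction arbitrary: t u)
  case (identity A)
  have t: "is_arrow \<L> L A t" using tree_arrows_is_arrow identity L by blast
  have eq: "compose (points L) u (compose (points L) (\<lambda>p\<in>points A. p) t) = compose (points L) u t"
    using arrow_point[OF sk t] by (auto simp: compose_def fun_eq_iff)
  show ?case
  proof (cases "A = L")
    case True
    then have "compose (points L) u t = \<one>\<^bsub>line_group \<L> L\<^esub>"
      using identity by (auto simp: tree_arrows_def one_line_group compose_def fun_eq_iff)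
    then show ?thesis unfolding eq by (simp add: generate.one)
  next
    case False
    obtain N where N: "t = line_map L A N" "N \<in> \<L>" "distinct [L, A, N]"
      using identity(2) False by (elim tree_arrowsE) auto
    obtain P where P: "u = line_map A L P" "P \<in> \<L>" "distinct [A, L, P]"
      using identity(3) False by (elim tree_arrowsE) auto
    have "compose (points L) u t \<in> two_step_loops \<L> L"
      unfolding N(1) P(1) using identity(1) N P by (intro two_step_loopsI)
    then show ?thesis unfolding eq by (intro generate.incl) (simp add: basic_loops_def)
  qed
next
  case (generator A B N)
  have t: "is_arrow \<L> L A t" and u: "is_arrow \<L> B L u" using tree_arrows_is_arrow generator L by blast+
  have f: "is_arrow \<L> A B (line_map A B N)" using generator by (intro is_arrow.generator)
  show ?case
  proof (cases "A = L \<or> B = L")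
    case True
    \<comment> \<open>One end of the generator is the centre L, where the closing edge is trivial.
      The generator and the other edge form a two-step loop.\<close>
    then have "compose (points L) u (compose (points L) (line_map A B N) t) \<in> two_step_loops \<L> L"
    proof
      assume A: "A = L"
      then have "B \<noteq> L" using generator(4) by auto
      then obtain P where P: "u = line_map B L P" "P \<in> \<L>" "distinct [B, L, P]"
        using generator(6) by (elim tree_arrowsE)
      have "t = (\<lambda>p\<in>points L. p)" using generator(5) by (simp add: A tree_arrows_refl)
      then have "compose (points L) u (compose (points L) (line_map A B N) t) = compose (points L) u (line_map L B N)"
        by (auto simp: A compose_def fun_eq_iff)
      then show ?thesis using A P generator(2-4) by (simp add: two_step_loopsI)
    next
      assume B: "B = L"
      then have "A \<noteq> L" using generator(4) by auto
      then obtain P where P: "t = line_map L A P" "P \<in> \<L>" "distinct [L, A, P]"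
        using generator(5) by (elim tree_arrowsE) auto
      have "u = (\<lambda>p\<in>points L. p)" using generator(6) by (simp add: B tree_arrows_refl)
      moreover have "line_map A L N (t p) \<in> points L" if "p \<in> points L" for p
        using arrow_point[OF sk f] arrow_point[OF sk t] that B by blast
      ultimately have "compose (points L) u (compose (points L) (line_map A B N) t) = compose (points L) (line_map A L N) t"
        by (auto simp: B compose_def fun_eq_iff)
      then show ?thesis using B P generator(1,3,4) by (simp add: two_step_loopsI)
    qed
    then show ?thesis by (intro generate.incl) (simp add: basic_loops_def)
  next
    case False
    \<comment> \<open>For i = L, j = A, k = B, l = N the loop \<open>x2\<close> is the one with
      three steps, whose closing edges have third indices B and A. The loops \<open>x1\<close> and
      \<open>x3\<close> exchange these edges for t and u: \<open>line_map A L B\<close> is inverse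
      to \<open>line_map L A B\<close>, and \<open>line_map L B A\<close> to
      \<open>line_map B L A\<close>, so x3 x2 x1 collapses to the closed-up generator.\<close>
    define x1 where "x1 = compose (points L) (line_map A L B) t"
    define x2 where "x2 = compose (points L) (line_map B L A) (compose (points L) (line_map A B N) (line_map L A B))"
    define x3 where "x3 = compose (points L) u (line_map L B A)"
    obtain N1 where N1: "t = line_map L A N1" "N1 \<in> \<L>" "distinct [L, A, N1]"
      using generator(5) False by (elim tree_arrowsE) auto
    obtain N2 where N2: "u = line_map B L N2" "N2 \<in> \<L>" "distinct [B, L, N2]"
      using generator(6) False by (elim tree_arrowsE) auto
    have "x1 \<in> two_step_loops \<L> L"
      unfolding x1_def N1(1) by (rule two_step_loopsI) (use False generator(1-4) N1 in auto)
    moreover have "x3 \<in> two_step_loops \<L> L"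
      unfolding x3_def N2(1) by (rule two_step_loopsI) (use False generator(1-4) N2 in auto)
    moreover have "x2 \<in> three_step_loops \<L> L"
      unfolding x2_def by (rule three_step_loopsI) (use False generator(1-4) in auto)
    ultimately have x: "x1 \<in> basic_loops \<L> L" "x2 \<in> basic_loops \<L> L" "x3 \<in> basic_loops \<L> L"
      by (simp_all add: basic_loops_def)
    have l: "is_line L" "is_line A" "is_line B" "skew L A" "skew A L" "skew L B" "skew B L" "skew A B" "skew B A"
      using sk L False generator(1-4) by (auto simp: skew_lines_def)
    have "compose (points L) u (compose (points L) (line_map A B N) t) = x3 \<otimes>\<^bsub>line_group \<L> L\<^esub> (x2 \<otimes>\<^bsub>line_group \<L> L\<^esub> x1)"
    proof
      fix p
      show "compose (points L) u (compose (points L) (line_map A B N) t) p =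
        (x3 \<otimes>\<^bsub>line_group \<L> L\<^esub> (x2 \<otimes>\<^bsub>line_group \<L> L\<^esub> x1)) p"
      proof (cases "p \<in> points L")
        case True
        then have tp: "t p \<in> points A" using arrow_point[OF sk t] by blast
        then have ftp: "line_map A B N (t p) \<in> points B" using arrow_point[OF sk f] by blast
        have 1: "line_map A L B (t p) \<in> points L" "line_map L A B (line_map A L B (t p)) = t p"
          using line_map_point[OF l(2,1,3,8,6) tp] by auto
        have 2: "line_map B L A (line_map A B N (t p)) \<in> points L"
          "line_map L B A (line_map B L A (line_map A B N (t p))) = line_map A B N (t p)"
          using line_map_point[OF l(3,1,2,9,4) ftp] by auto
        show ?thesis using True 1 2 by (simp add: mult_line_group x1_def x2_def x3_def compose_eq)
      qed (simp add: mult_line_group compose_def)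
    qed
    then show ?thesis using x by (simp add: generate.incl generate.eng)
  qed
next
  case (composite A M f B g)
  have M: "M \<in> \<L>" and AB: "A \<in> \<L>" "B \<in> \<L>" using arrow_dom[OF sk] composite by blast+
  \<comment> \<open>A detour from M to L and back along mutually inverse edges, that is, with the
    same third index. Inserted between f and g it splits u g f t into (u g t') (u' f t).\<close>
  obtain t' u' where tu: "t' \<in> tree_arrows \<L> L M" "u' \<in> tree_arrows \<L> M L" "\<And>p. p \<in> points M \<Longrightarrow> t' (u' p) = p"
  proof (cases "M = L")
    case True
    then show ?thesis using that[of "\<lambda>p\<in>points L. p" "\<lambda>p\<in>points L. p"] by (simp add: tree_arrows_def)
  next
    case False
    then obtain N where N: "N \<in> \<L>" "N \<noteq> L" "N \<noteq> M" using third_line_ex[OF c] by blast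
    have l: "is_line M" "is_line L" "is_line N" "skew M N" "skew L N"
      using sk L M N by (auto simp: skew_lines_def)
    show ?thesis using that[of "line_map L M N" "line_map M L N"] line_map_point(2)[OF l] False N
      by (auto simp: tree_arrows_def)
  qed
  have t: "is_arrow \<L> L A t" and u': "is_arrow \<L> M L u'"
    using tree_arrows_is_arrow L M AB composite.prems tu by blast+
  have "compose (points L) u (compose (points L) (compose (points A) g f) t) =
    compose (points L) u (compose (points L) g t') \<otimes>\<^bsub>line_group \<L> L\<^esub> compose (points L) u' (compose (points L) f t)"
  proof
    fix p
    show "compose (points L) u (compose (points L) (compose (points A) g f) t) p =
      (compose (points L) u (compose (points L) g t') \<otimes>\<^bsub>line_group \<L> L\<^esub> compose (points L) u' (compose (points L) f t)) p"
    proof (cases "p \<in> points L")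
      case True
      then have tp: "t p \<in> points A" using arrow_point[OF sk t] by blast
      then have ftp: "f (t p) \<in> points M" using arrow_point[OF sk composite.hyps(1)] by blast
      then have "u' (f (t p)) \<in> points L" using arrow_point[OF sk u'] by blast
      then show ?thesis using True tp tu(3)[OF ftp] by (simp add: mult_line_group compose_eq)
    qed (simp add: mult_line_group compose_def)
  qed
  then show ?case using composite.IH(1)[OF composite.prems(1) tu(2)] composite.IH(2)[OF tu(1) composite.prems(2)]
    by (simp add: generate.eng)
qed

text \<open>A loop at L is its own closing-up along the trivial edges, so the preceding lemma
  applies to it directly.\<close>

lemma line_group_generated:
  assumes sk: "skew_lines \<L>" and c: "card \<L> \<ge> 3" and L: "L \<in> \<L>"
  shows "carrier (line_group \<L> L) = generate (line_group \<L> L) (basic_loops \<L> L)"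
proof
  show "generate (line_group \<L> L) (basic_loops \<L> L) \<subseteq> carrier (line_group \<L> L)"
    using group.generate_incl[OF group_line_group[OF sk L] basic_loops_subset_carrier[of L \<L>]] L by blast
  show "carrier (line_group \<L> L) \<subseteq> generate (line_group \<L> L) (basic_loops \<L> L)"
  proof
    fix f assume "f \<in> carrier (line_group \<L> L)"
    then have f: "is_arrow \<L> L L f" by (simp add: carrier_line_group)
    let ?e = "\<lambda>p\<in>points L. p"
    have "compose (points L) ?e (compose (points L) f ?e) \<in> generate (line_group \<L> L) (basic_loops \<L> L)"
      by (rule closed_up_arrow_in_generate[OF sk c L f]) (simp_all add: tree_arrows_def)
    moreover have "compose (points L) ?e (compose (points L) f ?e) = f"
      using arrow_point[OF sk f] extensional_arb[OF arrow_extensional[OF sk f]]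
      by (auto simp: compose_def fun_eq_iff)
    ultimately show "f \<in> generate (line_group \<L> L) (basic_loops \<L> L)" by metis
  qed
qed

section \<open>Comparison of hom-sets and vertex groups\<close>

text \<open>The map f to t f s. Arbitrary s and t compare the hom-sets; mutually inverse ones give
  conjugation, which is multiplicative.\<close>

definition transport ::
    "'a::field subsp \<Rightarrow> ('a subsp \<Rightarrow> 'a subsp) \<Rightarrow> ('a subsp \<Rightarrow> 'a subsp) \<Rightarrow> ('a subsp \<Rightarrow> 'a subsp) \<Rightarrow> 'a subsp \<Rightarrow> 'a subsp" where
  "transport L s t f = compose (points L) t (compose (points L) f s)"

lemma transport_arrow:
  assumes "is_arrow \<L> L' L s" "is_arrow \<L> L M f" "is_arrow \<L> M M' t"
  shows "is_arrow \<L> L' M' (transport L' s t f)"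
  unfolding transport_def by (rule is_arrow.composite[OF is_arrow.composite[OF assms(1,2)] assms(3)])

lemma transport_inverse:
  assumes sk: "skew_lines \<L>" and s: "is_arrow \<L> L L' s'" and f: "is_arrow \<L> L M f"
    and "\<forall>p\<in>points L. s (s' p) = p" "\<forall>q\<in>points M. t' (t q) = q"
  shows "transport L s' t' (transport L' s t f) = f"
proof
  fix p
  show "transport L s' t' (transport L' s t f) p = f p"
    using arrow_point[OF sk s] arrow_point[OF sk f] assms(4,5) extensional_arb[OF arrow_extensional[OF sk f]]
    by (cases "p \<in> points L") (auto simp: transport_def compose_def)
qed

lemma bij_betw_transport:
  assumes sk: "skew_lines \<L>" and s: "is_arrow \<L> L' L s" and t: "is_arrow \<L> M M' t"
  shows "bij_betw (transport L' s t) {f. is_arrow \<L> L M f} {f. is_arrow \<L> L' M' f}"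
proof -
  obtain s' where s': "is_arrow \<L> L L' s'" "\<forall>p\<in>points L'. s' (s p) = p" "\<forall>q\<in>points L. s (s' q) = q"
    using arrow_inverse[OF sk s] by metis
  obtain t' where t': "is_arrow \<L> M' M t'" "\<forall>p\<in>points M. t' (t p) = p" "\<forall>q\<in>points M'. t (t' q) = q"
    using arrow_inverse[OF sk t] by metis
  have "transport L s' t' (transport L' s t f) = f" if "is_arrow \<L> L M f" for f
    using sk s'(1) that s'(3) t'(2) by (rule transport_inverse)
  moreover have "transport L' s t (transport L s' t' f) = f" if "is_arrow \<L> L' M' f" for f
    using sk s that s'(2) t'(3) by (rule transport_inverse)
  ultimately show ?thesis
    using transport_arrow[OF s _ t] transport_arrow[OF s'(1) _ t'(1)]
    by (intro bij_betw_byWitness[where f' = "transport L s' t'"]) auto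
qed

lemma line_group_transport_iso:
  assumes sk: "skew_lines \<L>" and c: "card \<L> \<ge> 3" and "L \<in> \<L>" "M \<in> \<L>"
  shows "\<exists>\<theta>. \<theta> \<in> iso (line_group \<L> L) (line_group \<L> M)"
proof -
  obtain t where t: "is_arrow \<L> L M t" using connecting_arrow_ex assms by blast
  obtain s where s: "is_arrow \<L> M L s" "\<And>p. p \<in> points L \<Longrightarrow> s (t p) = p" "\<And>q. q \<in> points M \<Longrightarrow> t (s q) = q"
    using arrow_inverse[OF sk t] by blast
  have "transport M s t (compose (points L) x y) = compose (points M) (transport M s t x) (transport M s t y)"
    if "is_arrow \<L> L L y" for x y
  proof
    fix p
    show "transport M s t (compose (points L) x y) p = compose (points M) (transport M s t x) (transport M s t y) p"
    proof (cases "p \<in> points M")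
      case True
      then have 1: "s p \<in> points L" using arrow_point[OF sk s(1)] by blast
      then have 2: "y (s p) \<in> points L" using arrow_point[OF sk that] by blast
      then have "t (y (s p)) \<in> points M" using arrow_point[OF sk t] by blast
      then show ?thesis using True 1 s(2)[OF 2] by (simp add: transport_def compose_eq)
    qed (simp add: compose_def transport_def)
  qed
  moreover have "bij_betw (transport M s t) (carrier (line_group \<L> L)) (carrier (line_group \<L> M))"
    unfolding carrier_line_group by (rule bij_betw_transport[OF sk s(1) t])
  ultimately have "transport M s t \<in> iso (line_group \<L> L) (line_group \<L> M)"
    unfolding iso_def hom_def by (auto simp: carrier_line_group mult_line_group bij_betw_def)
  then show ?thesis by blast
qed

lemma Hom_eqpoll:
  assumes sk: "skew_lines \<L>" and c: "card \<L> \<ge> 3" and "L \<in> \<L>" "M \<in> \<L>" "L' \<in> \<L>" "M' \<in> \<L>"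
  shows "Hom (line_groupoid \<L>) L M \<approx> Hom (line_groupoid \<L>) L' M'"
proof -
  obtain s t where "is_arrow \<L> L' L s" "is_arrow \<L> M M' t" using connecting_arrow_ex assms by blast
  then show ?thesis using bij_betw_transport[OF sk] unfolding eqpoll_def line_groupoid_def by fastforce
qed

lemma finite_arrows_iff:
  assumes sk: "skew_lines \<L>" and c: "card \<L> \<ge> 3"
  shows "finite (arrows (line_groupoid \<L>)) \<longleftrightarrow> (\<exists>L\<in>\<L>. finite (carrier (line_group \<L> L)))"
proof
  assume fin: "finite (arrows (line_groupoid \<L>))"
  obtain L where L: "L \<in> \<L>" using third_line_ex[OF c] by blast
  have "carrier (line_group \<L> L) \<subseteq> (\<lambda>(A, f, B). f) ` arrows (line_groupoid \<L>)"
    using L by (force simp: arrows_def carrier_line_group line_groupoid_def)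
  then show "\<exists>L\<in>\<L>. finite (carrier (line_group \<L> L))" using fin L finite_surj by blast
next
  assume "\<exists>L\<in>\<L>. finite (carrier (line_group \<L> L))"
  then obtain L where L: "L \<in> \<L>" "finite (Hom (line_groupoid \<L>) L L)"
    by (auto simp: carrier_line_group line_groupoid_def)
  have "finite (Hom (line_groupoid \<L>) A B)" if "A \<in> \<L>" "B \<in> \<L>" for A B
    using Hom_eqpoll[OF sk c L(1,1) that] L(2) by (simp add: eqpoll_finite_iff)
  then have "finite (\<Union>A\<in>\<L>. \<Union>B\<in>\<L>. (\<lambda>f. (A, f, B)) ` Hom (line_groupoid \<L>) A B)"
    using sk by (auto simp: skew_lines_def)
  moreover have "arrows (line_groupoid \<L>) \<subseteq> (\<Union>A\<in>\<L>. \<Union>B\<in>\<L>. (\<lambda>f. (A, f, B)) ` Hom (line_groupoid \<L>) A B)"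
    by (auto simp: arrows_def line_groupoid_def)
  ultimately show "finite (arrows (line_groupoid \<L>))" by (rule rev_finite_subset)
qed

text \<open>The centralizer of y is a subgroup, so it contains what its elements generate.\<close>

lemma (in group) commute_generate:
  assumes S: "S \<subseteq> carrier G" and y: "y \<in> carrier G" and comm: "\<And>s. s \<in> S \<Longrightarrow> s \<otimes> y = y \<otimes> s"
    and x: "x \<in> generate G S"
  shows "x \<otimes> y = y \<otimes> x"
  using x
proof induction
  case (inv s)
  then have s: "s \<in> carrier G" using S by blast
  have "inv s \<otimes> y = inv s \<otimes> (y \<otimes> s) \<otimes> inv s" using s y by (simp add: m_assoc)
  also have "\<dots> = inv s \<otimes> (s \<otimes> y) \<otimes> inv s" using comm[OF inv] by simp
  also have "\<dots> = y \<otimes> inv s" using s y by (simp flip: m_assoc)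
  finally show ?case .
next
  case (eng a b)
  then have ab: "a \<in> carrier G" "b \<in> carrier G" using generate_in_carrier[OF S] by blast+
  have "a \<otimes> b \<otimes> y = a \<otimes> (b \<otimes> y)" using ab y by (simp add: m_assoc)
  also have "\<dots> = a \<otimes> (y \<otimes> b)" using eng by simp
  also have "\<dots> = a \<otimes> y \<otimes> b" using ab y by (simp add: m_assoc)
  also have "\<dots> = y \<otimes> a \<otimes> b" using eng by simp
  also have "\<dots> = y \<otimes> (a \<otimes> b)" using ab y by (simp add: m_assoc)
  finally show ?case .
qed (use y comm in auto)

text \<open>\<open>commute_generate\<close> is used twice: with a generator in the role of y, which
  makes the generators central, and then with an arbitrary y.\<close>

lemma (in group) comm_group_if_generators_commute:
  assumes S: "S \<subseteq> carrier G" "carrier G = generate G S"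
    and comm: "\<And>x y. x \<in> S \<Longrightarrow> y \<in> S \<Longrightarrow> x \<otimes> y = y \<otimes> x"
  shows "comm_group G"
proof (rule group_comm_groupI)
  fix x y assume x: "x \<in> carrier G" and y: "y \<in> carrier G"
  have "s \<otimes> y = y \<otimes> s" if "s \<in> S" for s
    using commute_generate[OF S(1), of s y] comm that y S by force
  then show "x \<otimes> y = y \<otimes> x" using commute_generate[OF S(1) y] x S(2) by blast
qed

lemma (in comm_group) torsion_if_generators_torsion:
  assumes S: "S \<subseteq> carrier G" "carrier G = generate G S" and tor: "\<And>x. x \<in> S \<Longrightarrow> finite_order G x"
    and x: "x \<in> carrier G"
  shows "finite_order G x"
  using x unfolding S(2)
proof induction
  case one
  show ?case unfolding finite_order_def by (intro exI[of _ 1]) simp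
next
  case (inv s)
  then obtain n :: nat where "n > 0" "s [^] n = \<one>" using tor by (auto simp: finite_order_def)
  then show ?case unfolding finite_order_def using inv S
    by (intro exI[of _ n]) (auto simp: nat_pow_inv)
next
  case (eng a b)
  then have ab: "a \<in> carrier G" "b \<in> carrier G" using S(2) by blast+
  obtain m n :: nat where mn: "m > 0" "n > 0" "a [^] m = \<one>" "b [^] n = \<one>"
    using eng by (auto simp: finite_order_def)
  have "(a \<otimes> b) [^] (m * n) = a [^] (m * n) \<otimes> b [^] (m * n)" by (rule pow_mult_distrib[OF m_comm[OF ab] ab])
  also have "a [^] (m * n) = \<one>" using ab mn by (simp flip: nat_pow_pow)
  also have "b [^] (m * n) = \<one>" using ab mn by (subst mult.commute) (simp flip: nat_pow_pow)
  finally show ?case unfolding finite_order_def using mn by (intro exI[of _ "m * n"]) simp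
qed (rule tor)

lemma finite_imp_finite_order:
  assumes "group G" "finite (carrier G)" "x \<in> carrier G"
  shows "finite_order G x"
  unfolding finite_order_def
  using group.pow_order_eq_1[OF assms(1,3)] monoid.order_gt_0_iff_finite[OF group.is_monoid[OF assms(1)]] assms(2) by blast

section \<open>Torsion line groups are finite\<close>

fun map_mat2 :: "('a \<Rightarrow> 'b) \<Rightarrow> 'a mat2 \<Rightarrow> 'b mat2" where
  "map_mat2 h (Mat2 a b c d) = Mat2 (h a) (h b) (h c) (h d)"

lemma map_mat2_to_ac:
  "map_mat2 to_ac (A * B) = map_mat2 to_ac A * map_mat2 to_ac B"
  "map_mat2 to_ac 1 = 1"
  "det2 (map_mat2 to_ac A) = to_ac (det2 A)"
  "map_mat2 to_ac (adj2 A) = adj2 (map_mat2 to_ac A)"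
  by (cases A; cases B; simp add: one_mat2_def)+

locale line_coordinates =
  fixes \<L> :: "'a::field subsp set" and L e1 e2
  assumes skew: "skew_lines \<L>" and L: "L \<in> \<L>"
    and span_eq: "vec.span {e1, e2} = L"
    and indep: "\<And>x y. x *s e1 + y *s e2 = 0 \<Longrightarrow> x = 0 \<and> y = 0"
begin

lemma subspace_L: "vec.subspace L"
  using skew L by (auto simp: skew_lines_def is_line_def)

lemma e_in: "e1 \<in> L" "e2 \<in> L"
  using span_eq vec.span_base by blast+

lemma in_L_iff: "v \<in> L \<longleftrightarrow> (\<exists>x y. v = x *s e1 + y *s e2)"
proof
  assume "v \<in> L"
  then have "v \<in> vec.span {e1, e2}" by (simp add: span_eq)
  then obtain x where "v - x *s e1 \<in> vec.span {e2}" using vec.span_breakdown_eq[of v e1 "{e2}"] by blast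
  then obtain y where "v - x *s e1 = y *s e2" by (auto simp: vec.span_singleton)
  then have "v = x *s e1 + y *s e2" by (simp add: algebra_simps)
  then show "\<exists>x y. v = x *s e1 + y *s e2" by blast
qed (use subspace_L e_in in \<open>auto intro: vec.subspace_add vec.subspace_scale\<close>)

lemma coords_unique:
  assumes "x *s e1 + y *s e2 = x' *s e1 + y' *s e2"
  shows "x = x' \<and> y = y'"
proof -
  have "(x - x') *s e1 + (y - y') *s e2 = 0" using assms by (simp add: vec.scale_left_diff_distrib algebra_simps)
  from indep[OF this] show ?thesis by simp
qed

text \<open>The columns are the coordinates of the images of e1 and e2, so that composition of maps
  is the product in \<open>mat2\<close>.\<close>

fun coord_mat :: "'a ^ 4 ^ 4 \<Rightarrow> 'a mat2 \<Rightarrow> bool" where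
  "coord_mat A (Mat2 a b c d) \<longleftrightarrow> A *v e1 = a *s e1 + c *s e2 \<and> A *v e2 = b *s e1 + d *s e2"

definition represents :: "'a mat2 \<Rightarrow> ('a subsp \<Rightarrow> 'a subsp) \<Rightarrow> bool" where
  "represents B f \<longleftrightarrow> (\<exists>A. mat_emb A L L \<and> f = mat_act A L \<and> coord_mat A B)"

lemma coord_mat_apply:
  "coord_mat A (Mat2 a b c d) \<Longrightarrow>
    A *v (x *s e1 + y *s e2) = (a * x + b * y) *s e1 + (c * x + d * y) *s e2"
  by (simp add: vec.add vec.scale vec.scale_right_distrib vec.scale_left_distrib mult.commute add_ac)

lemma represents_ex:
  assumes "is_arrow \<L> L L f"
  shows "\<exists>B. represents B f"
proof -
  \<comment> \<open>The trivial extension: \<open>arrow_base_change\<close> is used here only to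
    obtain a matrix that induces f.\<close>
  interpret field_ext "\<lambda>x :: 'a. x" by unfold_locales (simp add: field_extension_def)
  obtain A where A: "mat_emb A L L" "f = mat_act A L" using arrow_base_change[OF skew assms] by blast
  then have "A *v e1 \<in> L" "A *v e2 \<in> L" using e_in by (auto simp: mat_emb_def)
  then obtain a b c d where "coord_mat A (Mat2 a b c d)" unfolding in_L_iff coord_mat.simps by blast
  then show ?thesis using A unfolding represents_def by blast
qed

lemma represents_1: "represents 1 (\<lambda>p\<in>points L. p)"
  unfolding represents_def one_mat2_def
  by (intro exI[of _ "mat 1"] conjI mat_emb_1) (simp_all only: mat_act_1 coord_mat.simps, simp)

lemma represents_mult:
  assumes "represents B f" "represents B' f'"
  shows "represents (B' * B) (compose (points L) f' f)"
proof -
  obtain A A' where A: "mat_emb A L L" "f = mat_act A L" "coord_mat A B"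
    and A': "mat_emb A' L L" "f' = mat_act A' L" "coord_mat A' B'" using assms by (auto simp: represents_def)
  have "coord_mat (A' ** A) (B' * B)"
  proof (cases B; cases B')
    fix a b c d a' b' c' d' assume B: "B = Mat2 a b c d" "B' = Mat2 a' b' c' d'"
    have "A *v e1 = a *s e1 + c *s e2" "A *v e2 = b *s e1 + d *s e2" using A(3) B by auto
    then show ?thesis using coord_mat_apply[OF A'(3)[unfolded B]]
      by (simp add: B flip: matrix_vector_mul_assoc)
  qed
  then show ?thesis
    using mat_emb_mult[OF A(1) A'(1)] mat_act_mult[OF A(1) subspace_L subspace_L, of A'] A A'
    by (auto simp: represents_def)
qed

lemma represents_det:
  assumes "represents B f"
  shows "det2 B \<noteq> 0"
proof
  assume 0: "det2 B = 0"
  obtain A where A: "mat_emb A L L" "coord_mat A B" using assms by (auto simp: represents_def)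
  obtain a b c d where B: "B = Mat2 a b c d" by (cases B)
  have ker: "x = 0 \<and> y = 0" if "a * x + b * y = 0" "c * x + d * y = 0" for x y
  proof (rule indep, rule mat_emb_eq_0[OF A(1)])
    show "x *s e1 + y *s e2 \<in> L" using in_L_iff by blast
    show "A *v (x *s e1 + y *s e2) = 0" using coord_mat_apply[OF A(2)[unfolded B]] that by simp
  qed
  \<comment> \<open>The kernel vectors (d, -c) and (-b, a) are the columns of the adjugate. If the
    determinant is 0, injectivity makes both vanish, so B = 0, which kills (1, 0) as well.\<close>
  have "d = 0 \<and> - c = 0" using 0 B by (intro ker) (auto simp: algebra_simps)
  moreover have "- b = 0 \<and> a = 0" using 0 B by (intro ker) (auto simp: algebra_simps)
  ultimately show False using ker[of 1 0] by simp
qed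

lemma represents_scale_eq:
  assumes "represents B f" "represents B' f'" "B' = scal c * B"
  shows "f = f'"
proof -
  obtain A A' where A: "mat_emb A L L" "f = mat_act A L" "coord_mat A B"
    and A': "mat_emb A' L L" "f' = mat_act A' L" "coord_mat A' B'" using assms by (auto simp: represents_def)
  obtain p q r s where B: "B = Mat2 p q r s" by (cases B)
  then have B': "B' = Mat2 (c * p) (c * q) (c * r) (c * s)" using assms(3) by (simp add: scal_def)
  have "A' *v v = c *s (A *v v)" if "v \<in> L" for v
  proof -
    obtain x y where v: "v = x *s e1 + y *s e2" using \<open>v \<in> L\<close> in_L_iff by blast
    show ?thesis unfolding v coord_mat_apply[OF A(3)[unfolded B]] coord_mat_apply[OF A'(3)[unfolded B']]
      by (simp add: vec.scale_right_distrib algebra_simps)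
  qed
  then show ?thesis unfolding A A' by (rule mat_act_scale[OF A'(1) subspace_L])
qed

lemma represents_id_scalar:
  assumes "represents B (\<lambda>p\<in>points L. p)"
  shows "\<exists>c. B = scal c"
proof -
  obtain A where A: "mat_emb A L L" "(\<lambda>p\<in>points L. p) = mat_act A L" "coord_mat A B"
    using assms by (auto simp: represents_def)
  then have "mat_act (mat 1) L = mat_act A L" by (simp only: mat_act_1)
  then obtain k where "\<forall>v\<in>L. A *v v = k *s (mat 1 *v v)"
    using mat_act_eq_imp_scale[OF mat_emb_1 A(1) subspace_L] by blast
  then have k: "A *v e1 = k *s e1 + 0 *s e2" "A *v e2 = 0 *s e1 + k *s e2" using e_in by auto
  obtain a b c d where B: "B = Mat2 a b c d" by (cases B)
  have "a = k \<and> c = 0" "b = 0 \<and> d = k" using A(3) k B by (auto intro!: coords_unique)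
  then show ?thesis using B by (intro exI[of _ k]) (simp add: scal_def)
qed

text \<open>A relation and not a function, because a lift of determinant 1 is determined by f only
  up to sign. The factor c is free here; \<open>lifts_ex\<close> takes it to be a square root of the
  inverse determinant.\<close>

definition lifts :: "'a alg_closure mat2 \<Rightarrow> ('a subsp \<Rightarrow> 'a subsp) \<Rightarrow> bool" where
  "lifts Y f \<longleftrightarrow> (\<exists>B c. represents B f \<and> c \<noteq> 0 \<and> Y = scal c * map_mat2 to_ac B)"

lemma lifts_1: "lifts 1 (\<lambda>p\<in>points L. p)"
  unfolding lifts_def using represents_1
  by (intro exI[of _ 1]) (simp add: scal_1 map_mat2_to_ac)

lemma lifts_mult:
  assumes "lifts Y f" "lifts Z g"
  shows "lifts (Z * Y) (compose (points L) g f)"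
proof -
  obtain B c where Y: "represents B f" "c \<noteq> 0" "Y = scal c * map_mat2 to_ac B" using assms by (auto simp: lifts_def)
  obtain D d where Z: "represents D g" "d \<noteq> 0" "Z = scal d * map_mat2 to_ac D" using assms by (auto simp: lifts_def)
  have "Z * Y = scal d * (map_mat2 to_ac D * scal c) * map_mat2 to_ac B" by (simp add: Y Z mult.assoc)
  also have "\<dots> = scal (d * c) * map_mat2 to_ac (D * B)"
    by (simp only: scal_central[of c "map_mat2 to_ac D", symmetric] scal_mult map_mat2_to_ac mult.assoc)
  finally show ?thesis using represents_mult[OF Y(1) Z(1)] Y(2) Z(2) unfolding lifts_def
    by (intro exI[of _ "D * B"] exI[of _ "d * c"]) simp
qed

lemma lifts_ex:
  assumes "is_arrow \<L> L L f"
  shows "\<exists>Y. det2 Y = 1 \<and> lifts Y f"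
proof -
  obtain B where B: "represents B f" using represents_ex assms by blast
  obtain c where c: "c ^ 2 = inverse (to_ac (det2 B))"
    using nth_root_exists[of 2 "inverse (to_ac (det2 B))"] by auto
  have "det2 (scal c * map_mat2 to_ac B) = c ^ 2 * to_ac (det2 B)"
    by (simp add: det2_mult det2_scal map_mat2_to_ac power2_eq_square)
  also have "\<dots> = 1" using represents_det[OF B] by (simp add: c)
  finally have "det2 (scal c * map_mat2 to_ac B) = 1" .
  moreover have "c \<noteq> 0" using c represents_det[OF B] by auto
  ultimately show ?thesis using B unfolding lifts_def by blast
qed

text \<open>The representatives B and D are proportional over the closure, so D times the adjugate
  of B is scalar there. Its entries lie in the base field, hence it is scalar over that field, and B
  and D induce the same map.\<close>

lemma lifts_unique:
  assumes "lifts Y f" "lifts Y g"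
  shows "f = g"
proof -
  obtain B c where Y: "represents B f" "c \<noteq> 0" "Y = scal c * map_mat2 to_ac B" using assms by (auto simp: lifts_def)
  obtain D d where Z: "represents D g" "d \<noteq> 0" "Y = scal d * map_mat2 to_ac D" using assms by (auto simp: lifts_def)
  have "scal (inverse d) * (scal d * map_mat2 to_ac D) = scal (inverse d) * (scal c * map_mat2 to_ac B)"
    using Y Z by simp
  then have D: "map_mat2 to_ac D = scal (inverse d * c) * map_mat2 to_ac B"
    using Z(2) by (simp add: scal_1 flip: mult.assoc scal_mult)
  have "map_mat2 to_ac (D * adj2 B) = scal (inverse d * c * to_ac (det2 B))"
    by (simp add: map_mat2_to_ac D mult.assoc adj2_mult scal_mult)
  moreover obtain x y z w where xyzw: "D * adj2 B = Mat2 x y z w" by (cases "D * adj2 B")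
  ultimately have "to_ac x = to_ac w" "to_ac y = 0" "to_ac z = 0" by (simp_all add: scal_def)
  then have x: "D * adj2 B = scal x" using xyzw by (simp add: scal_def)
  have "scal (det2 B) * D = D * (adj2 B * B)" by (simp only: scal_central[of _ D] adj2_mult)
  also have "\<dots> = scal x * B" by (simp only: x flip: mult.assoc)
  finally have "scal (det2 B) * D = scal x * B" .
  then have "scal (inverse (det2 B)) * (scal (det2 B) * D) = scal (inverse (det2 B)) * (scal x * B)" by simp
  then have "D = scal (inverse (det2 B) * x) * B"
    using represents_det[OF Y(1)] by (simp add: scal_1 flip: mult.assoc scal_mult)
  then show ?thesis using represents_scale_eq Y(1) Z(1) by blast
qed

text \<open>A lift of the identity is a scalar whose square is the determinant 1.\<close>

lemma lifts_id_square:
  assumes "lifts Y (\<lambda>p\<in>points L. p)" "det2 Y = 1"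
  shows "Y * Y = 1"
proof -
  obtain B c where Y: "represents B (\<lambda>p\<in>points L. p)" "Y = scal c * map_mat2 to_ac B"
    using assms by (auto simp: lifts_def)
  then obtain d where "B = scal d" using represents_id_scalar by blast
  then have "Y = scal (c * to_ac d)" using Y by (simp add: scal_def)
  then show ?thesis using assms(2) by (simp add: det2_scal scal_1 flip: scal_mult)
qed

lemma finite_line_group_if_torsion:
  assumes tor: "\<And>g. g \<in> carrier (line_group \<L> L) \<Longrightarrow> finite_order (line_group \<L> L) g"
    and S: "finite S" "S \<subseteq> carrier (line_group \<L> L)" "carrier (line_group \<L> L) = generate (line_group \<L> L) S"
  shows "finite (carrier (line_group \<L> L))"
proof -
  let ?G = "line_group \<L> L"
  interpret G: group ?G using skew L by (rule group_line_group)
  \<comment> \<open>\<open>submonoid_gen\<close> is closed under products only, so the inverses of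
    the generators are adjoined beforehand.\<close>
  define T where "T = S \<union> (\<lambda>s. inv\<^bsub>?G\<^esub> s) ` S"
  have T: "finite T" "T \<subseteq> carrier ?G" using S(1,2) by (auto simp: T_def)
  obtain Y where Y: "\<And>f. f \<in> carrier ?G \<Longrightarrow> det2 (Y f) = 1 \<and> lifts (Y f) f"
    using lifts_ex unfolding carrier_line_group mem_Collect_eq by metis
  let ?H = "submonoid_gen (Y ` T)"
  have H: "det2 Z = 1 \<and> (\<exists>f\<in>carrier ?G. lifts Z f)" if "Z \<in> ?H" for Z
    using that
  proof induction
    case one
    show ?case using lifts_1 G.one_closed unfolding one_line_group by (auto simp: det2_1)
  next
    case (mult s x)
    then obtain t f where t: "t \<in> T" "s = Y t" and f: "f \<in> carrier ?G" "lifts x f" by blast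
    then have "lifts (s * x) (t \<otimes>\<^bsub>?G\<^esub> f)" using lifts_mult[OF f(2)] Y T(2) by (auto simp: mult_line_group)
    moreover have "t \<otimes>\<^bsub>?G\<^esub> f \<in> carrier ?G" using t f T(2) by blast
    ultimately show ?case using mult t Y T(2) by (auto simp: det2_mult)
  qed
  have "finite ?H"
  proof (rule finite_torsion_submonoid_SL2)
    show "finite (Y ` T)" using T by simp
    show "det2 A = 1" if "A \<in> Y ` T" for A using H[OF submonoid_gen_incl[OF that]] by blast
    fix Z assume Z: "Z \<in> ?H"
    then obtain f where f: "f \<in> carrier ?G" "lifts Z f" using H by blast
    then obtain n :: nat where n: "n > 0" "f [^]\<^bsub>?G\<^esub> n = \<one>\<^bsub>?G\<^esub>" using tor by (auto simp: finite_order_def)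
    have "lifts (Z ^ k) (f [^]\<^bsub>?G\<^esub> k)" for k :: nat
    proof (induction k)
      case 0
      show ?case using lifts_1 by (simp only: G.nat_pow_0 one_line_group power_0)
    next
      case (Suc k)
      then show ?case using lifts_mult[OF f(2) Suc] by (simp add: mult_line_group power_Suc2 del: power_Suc)
    qed
    from this[of n] have "lifts (Z ^ n) (\<lambda>p\<in>points L. p)" using n(2) by (simp add: one_line_group)
    moreover have "det2 (Z ^ n) = 1" using H[OF submonoid_gen_power[OF Z]] by blast
    \<comment> \<open>If f has exponent n, the power Z^n lifts the identity and is 1 up to sign, so
      2n is an exponent of Z.\<close>
    ultimately have "Z ^ n * Z ^ n = 1" by (rule lifts_id_square)
    then show "\<exists>n>0. Z ^ n = 1" using n(1) by (intro exI[of _ "n + n"]) (simp add: power_add)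
  qed
  moreover have lift_T: "\<exists>Z\<in>?H. lifts Z t" if "t \<in> T" for t
    using Y[of t] T(2) that submonoid_gen_incl[of "Y t" "Y ` T"] by (intro bexI[of _ "Y t"]) auto
  \<comment> \<open>By \<open>lifts_unique\<close> a lift determines the group element below it, so
    the finite monoid of lifts maps onto the group.\<close>
  have "carrier ?G \<subseteq> (\<lambda>Z. SOME f. lifts Z f) ` ?H"
  proof
    fix f assume "f \<in> carrier ?G"
    then have "f \<in> generate ?G S" using S by simp
    then have "\<exists>Z\<in>?H. lifts Z f"
    proof induction
      case one
      show ?case using lifts_1 submonoid_gen.one unfolding one_line_group by blast
    next
      case (incl s)
      then have "s \<in> T" by (simp add: T_def)
      then show ?case by (rule lift_T)
    next
      case (inv s)
      then have "inv\<^bsub>?G\<^esub> s \<in> T" by (simp add: T_def)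
      then show ?case by (rule lift_T)
    next
      case (eng x y)
      then show ?case using lifts_mult submonoid_gen_mult unfolding mult_line_group by blast
    qed
    then obtain Z where Z: "Z \<in> ?H" "lifts Z f" by blast
    then have "(SOME f. lifts Z f) = f" using lifts_unique someI[of "lifts Z" f] by blast
    then show "f \<in> (\<lambda>Z. SOME f. lifts Z f) ` ?H" using Z by blast
  qed
  ultimately show ?thesis using finite_surj by blast
qed

end

lemma line_basis_ex:
  assumes "is_line L"
  shows "\<exists>e1 e2. vec.span {e1, e2} = L \<and> (\<forall>x y. x *s e1 + y *s e2 = 0 \<longrightarrow> x = 0 \<and> y = 0)"
proof -
  obtain B where B: "B \<subseteq> L" "vec.independent B" "L \<subseteq> vec.span B" "card B = vec.dim L"
    using vec.basis_exists by blast
  then obtain e1 e2 where e: "B = {e1, e2}" "e1 \<noteq> e2"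
    using assms by (auto simp: is_line_def card_2_iff)
  have "vec.span B = L" using B assms by (intro subset_antisym vec.span_minimal) (auto simp: is_line_def)
  moreover have "x = 0 \<and> y = 0" if "x *s e1 + y *s e2 = 0" for x y
  proof -
    let ?u = "\<lambda>v. if v = e1 then x else y"
    have "(\<Sum>v\<in>B. ?u v *s v) = 0" using e that by simp
    moreover have "finite B" using e by simp
    ultimately have "\<forall>v\<in>B. ?u v = 0" using vec.independentD[OF B(2) _ subset_refl, of ?u] by blast
    then show ?thesis using e by auto
  qed
  ultimately show ?thesis using e by blast
qed

lemma line_group_finite_iff_torsion:
  assumes sk: "skew_lines \<L>" and c: "card \<L> \<ge> 3" and L: "L \<in> \<L>"
  shows "finite (carrier (line_group \<L> L)) \<longleftrightarrow> (\<forall>g\<in>carrier (line_group \<L> L). finite_order (line_group \<L> L) g)"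
proof
  assume "finite (carrier (line_group \<L> L))"
  then show "\<forall>g\<in>carrier (line_group \<L> L). finite_order (line_group \<L> L) g"
    using finite_imp_finite_order[OF group_line_group[OF sk L]] by blast
next
  assume tor: "\<forall>g\<in>carrier (line_group \<L> L). finite_order (line_group \<L> L) g"
  have "is_line L" "finite \<L>" using sk L by (auto simp: skew_lines_def)
  then obtain e1 e2 where "vec.span {e1, e2} = L" "\<forall>x y. x *s e1 + y *s e2 = 0 \<longrightarrow> x = 0 \<and> y = 0"
    using line_basis_ex[of L] by auto
  then interpret line_coordinates \<L> L e1 e2 using sk L by unfold_locales auto
  show "finite (carrier (line_group \<L> L))"
    using finite_line_group_if_torsion[OF _ finite_basic_loops[OF \<open>finite \<L>\<close>] basic_loops_subset_carrier[OF L]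
      line_group_generated[OF sk c L]] tor by blast
qed

text \<open>Commuting torsion generators make the whole group commutative and torsion, and
  finiteness then follows from \<open>line_group_finite_iff_torsion\<close>.\<close>

lemma line_group_finite_comm_iff:
  assumes sk: "skew_lines \<L>" and c: "card \<L> \<ge> 3" and L: "L \<in> \<L>"
  shows "finite (carrier (line_group \<L> L)) \<and> comm_group (line_group \<L> L) \<longleftrightarrow>
    (\<forall>x\<in>basic_loops \<L> L. \<forall>y\<in>basic_loops \<L> L.
       x \<otimes>\<^bsub>line_group \<L> L\<^esub> y = y \<otimes>\<^bsub>line_group \<L> L\<^esub> x) \<and>
    (\<forall>x\<in>basic_loops \<L> L. finite_order (line_group \<L> L) x)"
proof -
  let ?G = "line_group \<L> L"
  interpret group ?G using sk L by (rule group_line_group)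
  note S = basic_loops_subset_carrier[OF L] line_group_generated[OF sk c L]
  show ?thesis
  proof (intro iffI conjI)
    assume "finite (carrier ?G) \<and> comm_group ?G"
    then have "comm_monoid ?G" by (simp add: comm_group_def)
    from comm_monoid.m_comm[OF this]
    show "\<forall>x\<in>basic_loops \<L> L. \<forall>y\<in>basic_loops \<L> L. x \<otimes>\<^bsub>?G\<^esub> y = y \<otimes>\<^bsub>?G\<^esub> x"
      using S(1) by blast
  next
    assume "finite (carrier ?G) \<and> comm_group ?G"
    then show "\<forall>x\<in>basic_loops \<L> L. finite_order ?G x" using S(1) finite_imp_finite_order[OF is_group] by blast
  next
    assume *: "(\<forall>x\<in>basic_loops \<L> L. \<forall>y\<in>basic_loops \<L> L. x \<otimes>\<^bsub>?G\<^esub> y = y \<otimes>\<^bsub>?G\<^esub> x) \<and>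
      (\<forall>x\<in>basic_loops \<L> L. finite_order ?G x)"
    then show "comm_group ?G" using comm_group_if_generators_commute[OF S] by blast
    then have "finite_order ?G x" if "x \<in> carrier ?G" for x
      using comm_group.torsion_if_generators_torsion[OF _ S _ that] * by blast
    then show "finite (carrier ?G)" unfolding line_group_finite_iff_torsion[OF sk c L] by blast
  qed
qed

section \<open>Larger configurations and finite fields\<close>

lemma is_arrow_mono:
  assumes "is_arrow \<L> L M f" "\<L> \<subseteq> \<M>"
  shows "is_arrow \<M> L M f"
  using assms(1)
proof induction
  case (identity L)
  then show ?case using assms(2) by (intro is_arrow.identity) auto
next
  case (generator L M N)
  then show ?case using assms(2) by (intro is_arrow.generator) auto
next
  case (composite L M f N g)
  from composite.IH show ?case by (rule is_arrow.composite)
qed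

lemma subgroupoid_mono:
  assumes "skew_lines \<L>" "skew_lines \<M>" "\<L> \<subseteq> \<M>"
  shows "subgroupoid (line_groupoid \<L>) (line_groupoid \<M>)"
  unfolding subgroupoid_def
proof (intro conjI)
  show "\<forall>A\<in>Ob (line_groupoid \<L>). \<forall>B\<in>Ob (line_groupoid \<L>).
      Hom (line_groupoid \<L>) A B \<subseteq> Hom (line_groupoid \<M>) A B"
    using is_arrow_mono[OF _ assms(3)] by (auto simp: line_groupoid_def)
qed (use assms groupoid_line_groupoid in \<open>simp_all add: line_groupoid_def\<close>)

text \<open>The canonical isomorphism, followed by the inclusion at the line L', embeds the group in
  the vertex group of L'. The line M need not come from the small field, so a transport within the
  larger groupoid is added.\<close>

lemma (in field_ext) line_group_embeds:
  assumes sk: "skew_lines \<L>" and c: "card \<L> \<ge> 3" and sk'': "skew_lines \<L>''" and sub: "base_change h ` \<L> \<subseteq> \<L>''"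
    and L: "L \<in> \<L>" and M: "M \<in> \<L>''"
  shows "\<exists>H. subgroup H (line_group \<L>'' M) \<and> line_group \<L> L \<cong> (line_group \<L>'' M)\<lparr>carrier := H\<rparr>"
proof -
  let ?G = "line_group \<L> L" and ?G1 = "line_group (base_change h ` \<L>) (base_change h L)"
    and ?G2 = "line_group \<L>'' (base_change h L)" and ?G3 = "line_group \<L>'' M"
  have "card \<L> = card (base_change h ` \<L>)" using base_change_inj_on[OF sk] by (simp add: card_image)
  also have "\<dots> \<le> card \<L>''" using sub sk'' by (intro card_mono) (auto simp: skew_lines_def)
  finally have "card \<L>'' \<ge> 3" using c by simp
  then obtain \<theta> where \<theta>: "\<theta> \<in> iso ?G2 ?G3"
    using line_group_transport_iso[OF sk''] sub L M by blast
  have \<phi>: "arrow_ext L L \<in> iso ?G ?G1"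
    using canonical_iso_vertex_iso[OF canonical_iso_arrow_ext[OF sk] L] .
  have G12: "carrier ?G1 \<subseteq> carrier ?G2"
    using is_arrow_mono sub by (auto simp: carrier_line_group)
  define \<psi> where "\<psi> = \<theta> \<circ> arrow_ext L L"
  have \<psi>: "\<psi> \<in> hom ?G ?G3"
  proof (rule homI)
    fix x y assume xy: "x \<in> carrier ?G" "y \<in> carrier ?G"
    then have 1: "arrow_ext L L x \<in> carrier ?G2" "arrow_ext L L y \<in> carrier ?G2"
      using \<phi> G12 by (auto simp: iso_def hom_def)
    then show "\<psi> x \<in> carrier ?G3" using \<theta> by (auto simp: \<psi>_def iso_def hom_def)
    have "arrow_ext L L (x \<otimes>\<^bsub>?G\<^esub> y) = arrow_ext L L x \<otimes>\<^bsub>?G2\<^esub> arrow_ext L L y"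
      using \<phi> xy by (auto simp: iso_def hom_def mult_line_group)
    then show "\<psi> (x \<otimes>\<^bsub>?G\<^esub> y) = \<psi> x \<otimes>\<^bsub>?G3\<^esub> \<psi> y"
      using \<theta> 1 by (auto simp: \<psi>_def iso_def hom_def)
  qed
  have "inj_on \<psi> (carrier ?G)"
    unfolding \<psi>_def using \<phi> \<theta> G12
    by (intro comp_inj_on) (auto simp: iso_def bij_betw_def intro: inj_on_subset)
  with \<psi> have "\<psi> \<in> iso ?G (?G3\<lparr>carrier := \<psi> ` carrier ?G\<rparr>)"
    by (auto simp: iso_def hom_def bij_betw_def)
  moreover have "subgroup (\<psi> ` carrier ?G) ?G3"
    using group_line_group[OF sk L] group_line_group[OF sk'' M] group_hom_axioms.intro[OF \<psi>]
    by (rule group_hom.img_is_subgroup[OF group_hom.intro])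
  ultimately show ?thesis by (auto simp: is_iso_def)
qed

lemma arrow_Bij:
  assumes "skew_lines \<L>" "is_arrow \<L> L L f"
  shows "f \<in> Bij (points L)"
proof -
  obtain g where g: "is_arrow \<L> L L g" "\<And>p. p \<in> points L \<Longrightarrow> g (f p) = p" "\<And>q. q \<in> points L \<Longrightarrow> f (g q) = q"
    using arrow_inverse[OF assms] by blast
  then have "bij_betw f (points L) (points L)"
    using arrow_point[OF assms] arrow_point[OF assms(1) g(1)] by (intro bij_betw_byWitness[where f' = g]) auto
  then show ?thesis using arrow_extensional[OF assms] by (simp add: Bij_def)
qed

lemma line_group_subgroup_BijGroup:
  assumes sk: "skew_lines \<L>" and L: "L \<in> \<L>"
  shows "subgroup (carrier (line_group \<L> L)) (BijGroup (points L))"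
    and "(\<lambda>x. x) \<in> hom (line_group \<L> L) (BijGroup (points L))"
proof -
  let ?G = "line_group \<L> L" and ?B = "BijGroup (points L)"
  have B: "x \<in> Bij (points L)" if "x \<in> carrier ?G" for x
    using that arrow_Bij[OF sk] by (simp add: carrier_line_group)
  have mult: "x \<otimes>\<^bsub>?B\<^esub> y = x \<otimes>\<^bsub>?G\<^esub> y" if "x \<in> carrier ?G" "y \<in> carrier ?G" for x y
    using B that by (simp add: BijGroup_def mult_line_group)
  show "(\<lambda>x. x) \<in> hom ?G ?B" using B mult by (auto simp: hom_def BijGroup_def)
  interpret G: group ?G using sk L by (rule group_line_group)
  interpret group_hom ?G ?B "\<lambda>x. x"
    using \<open>(\<lambda>x. x) \<in> hom ?G ?B\<close> group_BijGroup
    by (intro group_hom.intro group_hom_axioms.intro G.is_group)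
  show "subgroup (carrier ?G) ?B" using img_is_subgroup by simp
qed

lemma finite_line_group_finite_field:
  fixes \<L> :: "'a::field subsp set"
  assumes "finite (UNIV :: 'a set)" "skew_lines \<L>"
  shows "finite (carrier (line_group \<L> L))"
proof -
  have "finite (UNIV :: ('a ^ 4) set)"
  proof (rule finite_surj)
    show "finite (UNIV :: (4 \<Rightarrow> 'a) set)" using assms(1) by (simp add: finite_UNIV_fun)
    show "(UNIV :: ('a ^ 4) set) \<subseteq> range (\<lambda>f. \<chi> i. f i)"
    proof
      fix v :: "'a ^ 4"
      have "v = (\<chi> i. vec_nth v i)" by simp
      then show "v \<in> range (\<lambda>f. \<chi> i. f i)" by blast
    qed
  qed
  then have "finite (Pow (UNIV :: ('a ^ 4) set))" by (simp only: finite_Pow_iff)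
  then have "finite (points L)" by (rule rev_finite_subset) simp
  then have "finite (points L \<rightarrow>\<^sub>E points L)" by (intro finite_PiE)
  moreover have "carrier (line_group \<L> L) \<subseteq> points L \<rightarrow>\<^sub>E points L"
    using arrow_point[OF assms(2)] arrow_extensional[OF assms(2)]
    by (auto simp: carrier_line_group PiE_def)
  ultimately show ?thesis by (rule rev_finite_subset)
qed

theorem proposition2p1p3:
  fixes \<L> :: "('a::field ^ 4) set set"
  assumes "skew_lines \<L>" and "card \<L> \<ge> 3"
  shows "(\<forall>L\<in>\<L>. carrier (line_group \<L> L) = generate (line_group \<L> L) (basic_loops \<L> L) \<and>
          (\<exists>S. finite S \<and> S \<subseteq> carrier (line_group \<L> L) \<and>
               carrier (line_group \<L> L) = generate (line_group \<L> L) S)) \<and>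

     (\<forall>L\<in>\<L>. finite (carrier (line_group \<L> L)) \<longleftrightarrow>
          (\<forall>g\<in>carrier (line_group \<L> L). finite_order (line_group \<L> L) g)) \<and>

     ((\<forall>L\<in>\<L>. \<forall>M\<in>\<L>. line_group \<L> L \<cong> line_group \<L> M) \<and>
          (\<forall>L\<in>\<L>. \<forall>M\<in>\<L>. \<forall>L'\<in>\<L>. \<forall>M'\<in>\<L>.
             Hom (line_groupoid \<L>) L M \<approx> Hom (line_groupoid \<L>) L' M') \<and>
          (finite (arrows (line_groupoid \<L>)) \<longleftrightarrow>
             (\<exists>L\<in>\<L>. finite (carrier (line_group \<L> L))))) \<and>

     (\<forall>L\<in>\<L>. finite (carrier (line_group \<L> L)) \<and> comm_group (line_group \<L> L) \<longleftrightarrow>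
          (\<forall>x\<in>basic_loops \<L> L. \<forall>y\<in>basic_loops \<L> L.
             x \<otimes>\<^bsub>line_group \<L> L\<^esub> y = y \<otimes>\<^bsub>line_group \<L> L\<^esub> x) \<and>
          (\<forall>x\<in>basic_loops \<L> L. finite_order (line_group \<L> L) x)) \<and>

     (\<forall>h :: 'a \<Rightarrow> 'b::field. field_extension h \<longrightarrow>
          (\<exists>\<Phi>. canonical_iso h \<L> \<Phi> \<and>
             (\<forall>\<Psi>. canonical_iso h \<L> \<Psi> \<longrightarrow>
                (\<forall>L\<in>\<L>. \<forall>M\<in>\<L>. \<forall>f\<in>Hom (line_groupoid \<L>) L M. \<Psi> L M f = \<Phi> L M f)) \<and>
             (\<forall>L\<in>\<L>. \<Phi> L L \<in> iso (line_group \<L> L)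
                                 (line_group (base_change h ` \<L>) (base_change h L))))) \<and>

     (\<forall>(h :: 'a \<Rightarrow> 'b) \<L>''. field_extension h \<and> skew_lines \<L>'' \<and> base_change h ` \<L> \<subseteq> \<L>'' \<longrightarrow>
          subgroupoid (line_groupoid (base_change h ` \<L>)) (line_groupoid \<L>'') \<and>
          (\<forall>L\<in>\<L>. \<forall>M\<in>\<L>''. \<exists>H. subgroup H (line_group \<L>'' M) \<and>
             line_group \<L> L \<cong> (line_group \<L>'' M)\<lparr>carrier := H\<rparr>)) \<and>

     (finite (UNIV :: 'a set) \<longrightarrow> (\<forall>L\<in>\<L>.
          subgroup (carrier (line_group \<L> L)) (BijGroup (points L)) \<and>
          (\<lambda>x. x) \<in> hom (line_group \<L> L) (BijGroup (points L)) \<and>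
          finite (carrier (line_group \<L> L))))"
proof -
  note sk = assms(1) and c = assms(2)
  have fin: "finite \<L>" using sk by (simp add: skew_lines_def)
  have a: "\<forall>L\<in>\<L>. carrier (line_group \<L> L) = generate (line_group \<L> L) (basic_loops \<L> L) \<and>
      (\<exists>S. finite S \<and> S \<subseteq> carrier (line_group \<L> L) \<and>
         carrier (line_group \<L> L) = generate (line_group \<L> L) S)"
  proof
    fix L assume "L \<in> \<L>"
    then show "carrier (line_group \<L> L) = generate (line_group \<L> L) (basic_loops \<L> L) \<and>
      (\<exists>S. finite S \<and> S \<subseteq> carrier (line_group \<L> L) \<and>
         carrier (line_group \<L> L) = generate (line_group \<L> L) S)"
      using line_group_generated[OF sk c] finite_basic_loops[OF fin, of L] basic_loops_subset_carrier[of L \<L>]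
      by (intro conjI exI[of _ "basic_loops \<L> L"])
  qed
  have cc: "\<forall>L\<in>\<L>. \<forall>M\<in>\<L>. line_group \<L> L \<cong> line_group \<L> M"
    using line_group_transport_iso[OF sk c] by (auto simp: is_iso_def)
  have e: "\<exists>\<Phi>. canonical_iso h \<L> \<Phi> \<and>
             (\<forall>\<Psi>. canonical_iso h \<L> \<Psi> \<longrightarrow>
                (\<forall>L\<in>\<L>. \<forall>M\<in>\<L>. \<forall>f\<in>Hom (line_groupoid \<L>) L M. \<Psi> L M f = \<Phi> L M f)) \<and>
             (\<forall>L\<in>\<L>. \<Phi> L L \<in> iso (line_group \<L> L)
                                 (line_group (base_change h ` \<L>) (base_change h L)))"
    if "field_extension h" for h :: "'a \<Rightarrow> 'b"
  proof -
    interpret field_ext h by (rule field_ext.intro[OF that])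
    note can = canonical_iso_arrow_ext[OF sk]
    show ?thesis
    proof (intro exI[of _ arrow_ext] conjI allI impI ballI)
      show "canonical_iso h \<L> arrow_ext" by (rule can)
      show "\<Psi> L M f = arrow_ext L M f"
        if "canonical_iso h \<L> \<Psi>" "f \<in> Hom (line_groupoid \<L>) L M" for \<Psi> L M f
        using canonical_iso_unique[OF can that(1), of L M f] that(2) by (simp add: line_groupoid_def)
    qed (rule canonical_iso_vertex_iso[OF can])
  qed
  have f: "subgroupoid (line_groupoid (base_change h ` \<L>)) (line_groupoid \<L>'') \<and>
          (\<forall>L\<in>\<L>. \<forall>M\<in>\<L>''. \<exists>H. subgroup H (line_group \<L>'' M) \<and>
             line_group \<L> L \<cong> (line_group \<L>'' M)\<lparr>carrier := H\<rparr>)"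
    if "field_extension h \<and> skew_lines \<L>'' \<and> base_change h ` \<L> \<subseteq> \<L>''" for h :: "'a \<Rightarrow> 'b" and \<L>''
  proof -
    interpret field_ext h by (rule field_ext.intro[OF that[THEN conjunct1]])
    show ?thesis
      using that by (intro conjI ballI subgroupoid_mono[OF skew_lines_base_change[OF sk]]
        line_group_embeds[OF sk c]) simp_all
  qed
  show ?thesis
  proof (intro conjI)
    show "finite (arrows (line_groupoid \<L>)) \<longleftrightarrow> (\<exists>L\<in>\<L>. finite (carrier (line_group \<L> L)))"
      by (rule finite_arrows_iff[OF sk c])
    show "finite (UNIV :: 'a set) \<longrightarrow> (\<forall>L\<in>\<L>.
          subgroup (carrier (line_group \<L> L)) (BijGroup (points L)) \<and>
          (\<lambda>x. x) \<in> hom (line_group \<L> L) (BijGroup (points L)) \<and>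
          finite (carrier (line_group \<L> L)))"
      by (intro impI ballI conjI line_group_subgroup_BijGroup[OF sk] finite_line_group_finite_field[OF _ sk])
  qed (intro a cc ballI allI impI e f Hom_eqpoll[OF sk c] line_group_finite_iff_torsion[OF sk c]
      line_group_finite_comm_iff[OF sk c]; assumption)+
qed

end
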